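(* Let $k_1,\ldots,k_n\ge 2$ be integers, let $G=[0,k_1-1]\times\cdots\times[0,k_n-1]\subseteq\mathbb{R}^n$ and $N=\sum_{i=1}^n(k_i-1)$. Let $d\in[0,N]$ and $E\subseteq[0,N]$, and write \[ [0,d]\setminus E=\{t_\ell<\cdots<t_1\},\qquad E\setminus[0,d]=\{w_1<\cdots<w_r\}. \] Then \[ \mathrm{H}_d(\underline{E})=\sum_{w\in E\cap[0,d]}\genfrac{[}{]}{0pt}{}{G}{w}+\sum_{j=1}^{\min\{\ell,r\}}\min\bigg\{\genfrac{[}{]}{0pt}{}{G}{t_j},\genfrac{[}{]}{0pt}{}{G}{w_j}\bigg\}. \]
   Context: For integers $a\le b$, $[a,b]$ denotes the set of integers between $a$ and $b$. For $x\in G$, $\mathrm{wt}(x)=\sum_i x_i$. For a set of integers $F$, $\underline{F}=\{x\in G:\mathrm{wt}(x)\in F\}$, $\underline{j}=\underline{\{j\}}$, and $\genfrac{[}{]}{0pt}{}{G}{F}=|\underline{F}|$. For $A\subseteq\mathbb{R}^n$, $V(A)$ is the real vector space of all functions $A\to\mathbb{R}$, $V_d(A)$ is the subspace of functions admitting a representation by a real polynomial of degree at most $d$, and $\mathrm{H}_d(A)=\dim V_d(A)$ (the affine Hilbert function over $\mathbb{R}$). *)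

theory Defs
  imports
    "HOL-Analysis.Analysis"
    "HOL-Library.Poly_Mapping"
    "HOL-Library.Function_Algebras"
begin

definition grid :: "('n::finite \<Rightarrow> nat) \<Rightarrow> (real ^ 'n) set" where
  "grid k = {x. \<forall>i. x $ i \<in> real ` {0..k i - 1}}"

definition wt :: "real ^ 'n::finite \<Rightarrow> real" where
  "wt x = (\<Sum>i\<in>UNIV. x $ i)"

definition layer :: "('n::finite \<Rightarrow> nat) \<Rightarrow> nat set \<Rightarrow> (real ^ 'n) set" where
  "layer k F = {x \<in> grid k. wt x \<in> real ` F}"

definition layer_card :: "('n::finite \<Rightarrow> nat) \<Rightarrow> nat set \<Rightarrow> nat" where
  "layer_card k F = card (layer k F)"

text \<open>A real polynomial in variables indexed by \<open>'n\<close> is a finitely supported map from exponent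
  vectors to coefficients.\<close>

type_synonym 'n rpoly = "('n \<Rightarrow>\<^sub>0 nat) \<Rightarrow>\<^sub>0 real"

definition eval_rpoly :: "'n::finite rpoly \<Rightarrow> real ^ 'n \<Rightarrow> real" where
  "eval_rpoly p x =
     (\<Sum>m\<in>Poly_Mapping.keys p. Poly_Mapping.lookup p m * (\<Prod>i\<in>UNIV. (x $ i) ^ Poly_Mapping.lookup m i))"

text \<open>Total degree; the zero polynomial satisfies every bound.\<close>

definition degree_at_most :: "'n::finite rpoly \<Rightarrow> nat \<Rightarrow> bool" where
  "degree_at_most p d \<longleftrightarrow>
     (\<forall>m\<in>Poly_Mapping.keys p. (\<Sum>i\<in>UNIV. Poly_Mapping.lookup m i) \<le> d)"

text \<open>The vector space of functions \<open>A \<rightarrow> \<real>\<close> is modelled by the functions on the whole type that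
  vanish outside \<open>A\<close>, so that a function on \<open>A\<close> has exactly one representative; the operations
  are pointwise.\<close>

definition fun_space :: "'a set \<Rightarrow> ('a \<Rightarrow> real) set" where
  "fun_space A = {f. \<forall>x. x \<notin> A \<longrightarrow> f x = 0}"

definition fun_space_deg :: "nat \<Rightarrow> (real ^ 'n::finite) set \<Rightarrow> (real ^ 'n \<Rightarrow> real) set" where
  "fun_space_deg d A =
     {f \<in> fun_space A. \<exists>p. degree_at_most p d \<and> (\<forall>x\<in>A. f x = eval_rpoly p x)}"

definition fun_scale :: "real \<Rightarrow> ('a \<Rightarrow> real) \<Rightarrow> 'a \<Rightarrow> real" where
  "fun_scale c f = (\<lambda>x. c * f x)"

global_interpretation fun_vs: vector_space "fun_scale :: real \<Rightarrow> ('a \<Rightarrow> real) \<Rightarrow> 'a \<Rightarrow> real"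
  by unfold_locales (auto simp: fun_scale_def fun_eq_iff algebra_simps)

lemma subspace_fun_space: "fun_vs.subspace (fun_space A)"
  by (auto simp: fun_vs.subspace_def fun_space_def fun_scale_def)

definition hilbert_fn :: "nat \<Rightarrow> (real ^ 'n::finite) set \<Rightarrow> nat" where
  "hilbert_fn d A = fun_vs.dim (fun_space_deg d A)"

end

(* The space of functions on a product of chains is an sl2-module: raise and lower satisfy
   [lower, raise] = N - 2m in weight m and are adjoint for a positive inner product, so the vectors
   raise^s b, with b in a basis of ker lower in weight j and s <= N - 2j, form a basis. Expanding b
   in products of binomials gives a polynomial P_b of degree j which on layer w is
   raise^(w - j) b / (w - j)! and vanishes outside layers j, ..., N - j; moreover every polynomial
   of degree <= d is on the grid a sum of terms g(wt) P_b with deg g <= d - j. Hence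
     H_d(E) = sum_j m_j min(d + 1 - j, |E cap [j, N - j]|),
   where m_j is the number of the b of weight j. As the intervals [j, N - j] are nested and the
   layer w has size sum {m_j. j <= w <= N - j}, the claim reduces to an identity of cardinalities
   for each single j. *)
theory Submission
  imports Defs "HOL-Computational_Algebra.Polynomial"
begin

section \<open>Linear algebra in function spaces\<close>

text \<open>On layer w the P_b with j <= w <= N - j are, up to factorials, a basis of the functions
  on that layer. Hence a relation among functions g(wt) P_b on E can be tested layer by layer and
  splits into one relation in the variable wt for each b. For fixed b only the values of g on E cap
  [j, N - j] count, and polynomials of degree at most d - j give min(d + 1 - j, |E cap [j, N - j]|)
  independent value vectors there. The factor g comes from (w - j)! / (w - m)!, a polynomial in w of
  degree m - j, which appears when a delta function of level m is expanded in strings and pushed up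
  to level w. No representation theory is quoted: positivity of the inner product turns the
  commutation relation into norm identities, whose sign makes raise injective below the middle and
  lower injective above it. In the identity for one j, the t_i decrease and the w_i increase, so t_i
  >= j and w_i <= N - j each select an initial segment of the indices; the common indices number the
  smaller of the two lengths.\<close>

global_interpretation fun_vs_pair: vector_space_pair
  "fun_scale :: real \<Rightarrow> ('a \<Rightarrow> real) \<Rightarrow> 'a \<Rightarrow> real"
  "fun_scale :: real \<Rightarrow> ('b \<Rightarrow> real) \<Rightarrow> 'b \<Rightarrow> real"
  by unfold_locales

lemma sum_fun_apply: "sum f A x = (\<Sum>i\<in>A. f i x)"
  for f :: "'i \<Rightarrow> 'a \<Rightarrow> real"
  by (induction A rule: infinite_finite_induct) auto

lemma fun_scale_apply [simp]: "fun_scale c f x = c * f x"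
  by (simp add: fun_scale_def)

text \<open>The bases below are indexed families whose size has to be counted, so the indexing must
  be injective as well. Two equal members would give the nontrivial relation with coefficients 1 and
  -1.\<close>

lemma independent_familyI:
  fixes \<Phi> :: "'i \<Rightarrow> 'a \<Rightarrow> real"
  assumes fin: "finite T"
    and triv: "\<And>c i. (\<And>x. (\<Sum>i\<in>T. c i * \<Phi> i x) = 0) \<Longrightarrow> i \<in> T \<Longrightarrow> c i = 0"
  shows "inj_on \<Phi> T" "fun_vs.independent (\<Phi> ` T)"
proof -
  show inj: "inj_on \<Phi> T"
  proof (rule inj_onI, rule ccontr)
    fix i j assume ij: "i \<in> T" "j \<in> T" "\<Phi> i = \<Phi> j" "i \<noteq> j"
    define c :: "'i \<Rightarrow> real" where "c = (\<lambda>l. (if l = i then 1 else 0) - (if l = j then 1 else 0))"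
    have "(\<Sum>l\<in>T. c l * \<Phi> l x) = 0" for x
      using fin ij by (simp add: c_def left_diff_distrib sum_subtractf if_distrib[of "\<lambda>z. z * _"] cong: if_cong)
    from triv[OF this ij(1)] ij(4) show False by (simp add: c_def)
  qed
  show "fun_vs.independent (\<Phi> ` T)"
  proof (rule fun_vs.independent_if_scalars_zero)
    fix f :: "('a \<Rightarrow> real) \<Rightarrow> real" and g
    assume z: "(\<Sum>g\<in>\<Phi> ` T. fun_scale (f g) g) = 0" and g: "g \<in> \<Phi> ` T"
    have "(\<Sum>i\<in>T. f (\<Phi> i) * \<Phi> i x) = 0" for x
      using fun_cong[OF z, of x] by (simp add: sum_fun_apply sum.reindex[OF inj])
    from triv[OF this] g show "f g = 0" by auto
  qed (use fin in simp)
qed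

lemma independent_coeffs_zero:
  assumes "fun_vs.independent B" "finite B" "\<And>x. (\<Sum>b\<in>B. c b * b x) = 0" "b \<in> B"
  shows "c b = 0"
proof -
  have "(\<Sum>b\<in>B. fun_scale (c b) b) = 0"
    using assms(3) by (auto simp: fun_eq_iff sum_fun_apply)
  with assms show ?thesis
    using fun_vs.independentD[of B B c b] by auto
qed

lemma delta_basis:
  fixes A :: "'a set"
  assumes "finite A"
  defines "\<delta> \<equiv> \<lambda>a::'a. indicator {a} :: 'a \<Rightarrow> real"
  shows "inj_on \<delta> A" "fun_vs.independent (\<delta> ` A)" "fun_vs.span (\<delta> ` A) = fun_space A"
proof -
  have tr: "c i = 0" if "\<And>x. (\<Sum>i\<in>A. c i * \<delta> i x) = 0" "i \<in> A" for c i
    using that(1)[of i] that(2) assms(1) by (simp add: \<delta>_def indicator_def)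
  show "inj_on \<delta> A" "fun_vs.independent (\<delta> ` A)"
    using independent_familyI[where \<Phi> = \<delta>, OF assms(1)] tr by blast+
  show "fun_vs.span (\<delta> ` A) = fun_space A"
  proof
    show "fun_vs.span (\<delta> ` A) \<subseteq> fun_space A"
      by (rule fun_vs.span_minimal[OF _ subspace_fun_space]) (auto simp: fun_space_def \<delta>_def indicator_def)
    show "fun_space A \<subseteq> fun_vs.span (\<delta> ` A)"
    proof
      fix v assume v: "v \<in> fun_space A"
      have "v = (\<Sum>a\<in>A. fun_scale (v a) (\<delta> a))"
      proof
        fix x
        have "(\<Sum>a\<in>A. v a * \<delta> a x) = (\<Sum>a\<in>A. if x = a then v a else 0)"
          by (intro sum.cong) (auto simp: \<delta>_def)
        then show "v x = (\<Sum>a\<in>A. fun_scale (v a) (\<delta> a)) x"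
          using v assms(1) by (auto simp: sum_fun_apply fun_space_def)
      qed
      also have "\<dots> \<in> fun_vs.span (\<delta> ` A)"
        by (intro fun_vs.span_sum fun_vs.span_scale fun_vs.span_base) auto
      finally show "v \<in> fun_vs.span (\<delta> ` A)" .
    qed
  qed
qed

lemma card_basis_fun_space:
  fixes A :: "'a set"
  assumes "finite A" "fun_vs.independent B" "fun_vs.span B = fun_space A"
  shows "card B = card A"
proof -
  note d = delta_basis[OF assms(1)]
  have "card B = fun_vs.dim (fun_space A)"
    using fun_vs.dim_span_eq_card_independent[OF assms(2)] assms(3) by simp
  also have "\<dots> = card ((\<lambda>a. indicator {a} :: 'a \<Rightarrow> real) ` A)"
    using fun_vs.dim_span_eq_card_independent[OF d(2)] d(3) by simp
  finally show ?thesis using card_image[OF d(1)] by simp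
qed

lemma finite_independent_fun_space:
  assumes "finite A" "fun_vs.independent B" "B \<subseteq> fun_space A"
  shows "finite B"
  using fun_vs.independent_span_bound[OF _ assms(2)] delta_basis(3)[OF assms(1)] assms by blast

text \<open>The images of the delta functions are \<open>card A\<close> independent vectors; a
  \<open>w\<close> outside their span would give \<open>card A + 1\<close> independent vectors in a
  space spanned by \<open>card A\<close>.\<close>

lemma linear_inj_imp_surj_fun_space:
  fixes A :: "'a set"
  assumes fin: "finite A"
    and lin: "Vector_Spaces.linear fun_scale fun_scale L"
    and into: "\<And>v. v \<in> fun_space A \<Longrightarrow> L v \<in> fun_space A"
    and ker: "\<And>v. v \<in> fun_space A \<Longrightarrow> L v = 0 \<Longrightarrow> v = 0"
    and w: "w \<in> fun_space A"
  obtains v where "v \<in> fun_space A" "L v = w"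
proof -
  let ?B = "(\<lambda>a. indicator {a} :: 'a \<Rightarrow> real) ` A"
  note d = delta_basis[OF fin]
  have inj: "inj_on L (fun_space A)"
    using fun_vs_pair.linear_inj_on_iff_eq_0[OF lin subspace_fun_space] ker by blast
  have ind: "fun_vs.independent (L ` ?B)"
    using fun_vs_pair.linear_independent_injective_image[OF lin d(2)] inj d(3) by simp
  have BA: "?B \<subseteq> fun_space A" using fun_vs.span_superset[of ?B] d(3) by simp
  have card: "card (L ` ?B) = card A"
    using card_image[OF inj_on_subset[OF inj BA]] card_image[OF d(1)] by simp
  have "w \<in> fun_vs.span (L ` ?B)"
  proof (rule ccontr)
    assume n: "w \<notin> fun_vs.span (L ` ?B)"
    have "fun_vs.independent (insert w (L ` ?B))"
      by (rule fun_vs.independent_insertI[OF n ind])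
    moreover have "insert w (L ` ?B) \<subseteq> fun_vs.span ?B"
      using BA d(3) into w by auto
    ultimately have "card (insert w (L ` ?B)) \<le> card ?B"
      using fun_vs.independent_span_bound[OF finite_imageI[OF fin]] by blast
    moreover have "w \<notin> L ` ?B" using n by (metis fun_vs.span_base)
    ultimately show False by (simp add: card fin card_image[OF d(1)] del: image_insert)
  qed
  then have "w \<in> L ` fun_space A"
    by (simp only: fun_vs_pair.linear_span_image[OF lin, of ?B] d(3))
  then show thesis using that by blast
qed

lemma span_image_coeffs:
  fixes \<Phi> :: "'i \<Rightarrow> 'a \<Rightarrow> real"
  assumes "finite T" "f \<in> fun_vs.span (\<Phi> ` T)"
  obtains c where "\<And>x. f x = (\<Sum>i\<in>T. c i * \<Phi> i x)"
proof -
  let ?V = "{f. \<exists>c. \<forall>x. f x = (\<Sum>i\<in>T. c i * \<Phi> i x)}"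
  have "fun_vs.subspace ?V"
  proof (rule fun_vs.subspaceI)
    show "0 \<in> ?V" by (auto intro!: exI[of _ "\<lambda>_. 0"])
  next
    fix f g assume "f \<in> ?V" "g \<in> ?V"
    then obtain c e where "\<forall>x. f x = (\<Sum>i\<in>T. c i * \<Phi> i x)" "\<forall>x. g x = (\<Sum>i\<in>T. e i * \<Phi> i x)" by blast
    then have "\<forall>x. (f + g) x = (\<Sum>i\<in>T. (c i + e i) * \<Phi> i x)"
      by (simp add: distrib_right sum.distrib)
    then show "f + g \<in> ?V" by (auto intro: exI[of _ "\<lambda>i. c i + e i"])
  next
    fix r f assume "f \<in> ?V"
    then obtain c where "\<forall>x. f x = (\<Sum>i\<in>T. c i * \<Phi> i x)" by blast
    then have "\<forall>x. fun_scale r f x = (\<Sum>i\<in>T. (r * c i) * \<Phi> i x)"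
      by (simp add: sum_distrib_left mult.assoc)
    then show "fun_scale r f \<in> ?V" by (auto intro: exI[of _ "\<lambda>i. r * c i"])
  qed
  moreover have "\<Phi> ` T \<subseteq> ?V"
  proof clarify
    fix i assume "i \<in> T"
    then have "\<forall>x. \<Phi> i x = (\<Sum>l\<in>T. (if l = i then 1 else 0) * \<Phi> l x)"
      using assms(1) by (simp add: if_distrib[of "\<lambda>z. z * _"] cong: if_cong)
    then show "\<exists>c. \<forall>x. \<Phi> i x = (\<Sum>i\<in>T. c i * \<Phi> i x)"
      by (rule exI[of _ "\<lambda>l. if l = i then 1 else 0"])
  qed
  ultimately have "fun_vs.span (\<Phi> ` T) \<subseteq> ?V" by (rule fun_vs.span_minimal[rotated])
  then show thesis using assms(2) that by blast
qed

lemma linear_mult_fun: "Vector_Spaces.linear fun_scale fun_scale (\<lambda>f x. h x * f x)"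
  unfolding Vector_Spaces.linear_iff
  by (auto simp: fun_vs.vector_space_axioms fun_eq_iff algebra_simps)

lemma mult_mem_span:
  assumes "f \<in> fun_vs.span S" "\<And>g. g \<in> S \<Longrightarrow> (\<lambda>x. h x * g x) \<in> fun_vs.span S'"
  shows "(\<lambda>x. h x * f x) \<in> fun_vs.span S'"
proof -
  have "(\<lambda>f x. h x * f x) ` fun_vs.span S = fun_vs.span ((\<lambda>f x. h x * f x) ` S)"
    using fun_vs_pair.linear_span_image[OF linear_mult_fun, of h S] by (rule sym)
  also have "\<dots> \<subseteq> fun_vs.span S'"
    by (rule fun_vs.span_minimal[OF _ fun_vs.subspace_span]) (use assms(2) in auto)
  finally show ?thesis using assms(1) by blast
qed

section \<open>Polynomial functions\<close>

text \<open>Stated with sums on both sides, so that an entry can be raised or lowered without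
  truncated subtraction.\<close>

lemma sum_fun_upd: "sum (m(i := n)) UNIV + m i = sum m UNIV + n" for m :: "'n::finite \<Rightarrow> nat"
proof -
  have "sum (m(i := n)) UNIV = n + sum m (UNIV - {i})"
    by (subst sum.remove[of _ i]) (auto intro!: sum.cong)
  moreover have "sum m UNIV = m i + sum m (UNIV - {i})" by (simp add: sum.remove)
  ultimately show ?thesis by simp
qed

text \<open>One construction for two bases: powers for \<open>g\<close> give the monomials,
  \<open>gchoose\<close> gives the products of binomials.\<close>

definition tensor :: "(nat \<Rightarrow> real \<Rightarrow> real) \<Rightarrow> ('n::finite \<Rightarrow> nat) \<Rightarrow> real ^ 'n \<Rightarrow> real" where
  "tensor g m x = (\<Prod>i\<in>UNIV. g (m i) (x $ i))"

definition tensors :: "(nat \<Rightarrow> real \<Rightarrow> real) \<Rightarrow> nat \<Rightarrow> (real ^ 'n::finite \<Rightarrow> real) set" where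
  "tensors g d = tensor g ` {m. sum m UNIV \<le> d}"

lemma span_tensors_mono: "d \<le> e \<Longrightarrow> fun_vs.span (tensors g d) \<subseteq> fun_vs.span (tensors g e)"
  by (rule fun_vs.span_mono) (auto simp: tensors_def)

lemma tensor_remove: "tensor g m x = g (m i) (x $ i) * (\<Prod>l\<in>UNIV - {i}. g (m l) (x $ l))"
  by (simp add: tensor_def prod.remove)

lemma tensor_upd: "tensor g (m(i := n)) x = g n (x $ i) * (\<Prod>l\<in>UNIV - {i}. g (m l) (x $ l))"
proof -
  have "(\<Prod>l\<in>UNIV - {i}. g ((m(i := n)) l) (x $ l)) = (\<Prod>l\<in>UNIV - {i}. g (m l) (x $ l))"
    by (intro prod.cong) auto
  then show ?thesis by (simp add: tensor_remove[of g _ x i])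
qed

text \<open>Multiplication by one coordinate touches a single factor, which the recurrence replaces
  by those of index \<open>Suc n\<close> and \<open>n\<close>; the total degree grows by at most
  1.\<close>

lemma coord_mult_span_tensors:
  fixes f :: "real ^ 'n::finite \<Rightarrow> real"
  assumes h: "\<And>n x. x * h n x = \<alpha> n * h (Suc n) x + \<beta> n * h n x"
    and f: "f \<in> fun_vs.span (tensors h d)"
  shows "(\<lambda>x. x $ i * f x) \<in> fun_vs.span (tensors h (Suc d))"
proof (rule mult_mem_span[OF f])
  fix g :: "real ^ 'n \<Rightarrow> real" assume "g \<in> tensors h d"
  then obtain m where m: "g = tensor h m" "sum m UNIV \<le> d" by (auto simp: tensors_def)
  have "(\<lambda>x. x $ i * g x) = fun_scale (\<alpha> (m i)) (tensor h (m(i := Suc (m i)))) + fun_scale (\<beta> (m i)) (tensor h m)"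
    unfolding m(1) fun_eq_iff
    by (simp add: tensor_upd tensor_remove[of h m _ i] mult.assoc[symmetric] h distrib_right)
  moreover have "tensor h (m(i := Suc (m i))) \<in> tensors h (Suc d)"
    unfolding tensors_def using m(2) sum_fun_upd[of m i "Suc (m i)"] by (intro imageI) (simp del: fun_upd_apply)
  moreover have "tensor h m \<in> tensors h (Suc d)"
    unfolding tensors_def using m(2) by (intro imageI) simp
  ultimately show "(\<lambda>x. x $ i * g x) \<in> fun_vs.span (tensors h (Suc d))"
    by (simp only:) (intro fun_vs.span_add fun_vs.span_scale fun_vs.span_base)
qed

text \<open>Peeling one affine factor off \<open>g\<close> lowers the total degree by 1; the rest is
  spanned by tensors of \<open>h\<close> by induction, and the recurrence of \<open>h\<close>
  absorbs the factor. Exchanging the roles of powers and binomials yields both inclusions between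
  their spans.\<close>

lemma span_tensors_subset:
  assumes h: "\<And>n x. x * h n x = \<alpha> n * h (Suc n) x + \<beta> n * h n x" "\<And>x. h 0 x = 1"
    and g: "\<And>n x. g (Suc n) x = (\<gamma> n * x + \<epsilon> n) * g n x" "\<And>x. g 0 x = 1"
  shows "fun_vs.span (tensors g d :: (real ^ 'n::finite \<Rightarrow> real) set) \<subseteq> fun_vs.span (tensors h d)"
proof -
  have "tensor g m \<in> fun_vs.span (tensors h s)" if "sum m UNIV = s" for m :: "'n \<Rightarrow> nat" and s
    using that
  proof (induction s arbitrary: m)
    case 0
    then have "m = (\<lambda>_. 0)" by auto
    then have "tensor g m = tensor h m" by (simp add: tensor_def g h fun_eq_iff)
    moreover have "tensor h m \<in> tensors h 0" using 0 by (simp add: tensors_def)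
    ultimately show ?case by (simp only: fun_vs.span_base)
  next
    case (Suc s)
    then obtain i where "m i \<noteq> 0"
      by (metis Zero_not_Suc sum.neutral)
    then obtain n where n: "m i = Suc n" by (cases "m i") auto
    let ?m = "m(i := n)"
    have "sum ?m UNIV = s" using sum_fun_upd[of m i n] n Suc.prems by linarith
    then have IH: "tensor g ?m \<in> fun_vs.span (tensors h s)" by (rule Suc.IH)
    have "tensor g m = fun_scale (\<gamma> n) (\<lambda>x. x $ i * tensor g ?m x) + fun_scale (\<epsilon> n) (tensor g ?m)"
      by (simp add: fun_eq_iff tensor_upd tensor_remove[of g m _ i] n g algebra_simps)
    moreover have "tensor g ?m \<in> fun_vs.span (tensors h (Suc s))"
      using IH span_tensors_mono[of s "Suc s" h] by auto
    ultimately show ?case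
      using coord_mult_span_tensors[OF h(1) IH, of i]
      by (simp only:) (intro fun_vs.span_add fun_vs.span_scale)
  qed
  then have "tensors g d \<subseteq> fun_vs.span (tensors h d :: (real ^ 'n \<Rightarrow> real) set)"
    using span_tensors_mono unfolding tensors_def[of g] by blast
  then show ?thesis by (rule fun_vs.span_minimal[OF _ fun_vs.subspace_span])
qed

definition polyfn :: "nat \<Rightarrow> (real ^ 'n::finite \<Rightarrow> real) set" where
  "polyfn d = fun_vs.span (tensors (\<lambda>n x. x ^ n) d)"

lemma mult_gbinomial_Suc: "x * (x gchoose n) = real (Suc n) * (x gchoose Suc n) + real n * (x gchoose n)"
  for x :: real
  using gbinomial_mult_1[of x n] by (simp add: algebra_simps)

lemma gbinomial_Suc_linear: "x gchoose Suc n = (1 / real (Suc n) * x + - (real n / real (Suc n))) * (x gchoose n)"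
  for x :: real
proof -
  have "real (Suc n) * (x gchoose Suc n) = (x - real n) * (x gchoose n)"
    using mult_gbinomial_Suc[of x n] by (simp add: algebra_simps)
  then have "x gchoose Suc n = (x - real n) / real (Suc n) * (x gchoose n)"
    by (simp add: field_simps)
  then show ?thesis by (simp add: diff_divide_distrib)
qed

lemma polyfn_eq_span_gbinomial: "polyfn d = fun_vs.span (tensors (\<lambda>n x. x gchoose n) d)"
proof -
  show ?thesis unfolding polyfn_def
  proof
    show "fun_vs.span (tensors (\<lambda>n x. x ^ n) d) \<subseteq> fun_vs.span (tensors (\<lambda>n x. x gchoose n) d)"
      by (rule span_tensors_subset[where \<alpha> = "\<lambda>n. real (Suc n)" and \<beta> = real and \<gamma> = "\<lambda>_. 1" and \<epsilon> = "\<lambda>_. 0"])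
        (use mult_gbinomial_Suc in auto)
    show "fun_vs.span (tensors (\<lambda>n x. x gchoose n) d) \<subseteq> fun_vs.span (tensors (\<lambda>n x. x ^ n) d)"
      by (rule span_tensors_subset[where \<alpha> = "\<lambda>_. 1" and \<beta> = "\<lambda>_. 0"
            and \<gamma> = "\<lambda>n. 1 / real (Suc n)" and \<epsilon> = "\<lambda>n. - (real n / real (Suc n))"])
        (use gbinomial_Suc_linear in auto)
  qed
qed

lemma polyfn_mono: "d \<le> e \<Longrightarrow> polyfn d \<subseteq> polyfn e"
  unfolding polyfn_def by (rule span_tensors_mono)

lemma wt_mult_polyfn:
  assumes "f \<in> polyfn d"
  shows "(\<lambda>x. wt x * f x) \<in> polyfn (Suc d)"
proof -
  have "(\<lambda>x. x $ i * f x) \<in> polyfn (Suc d)" for i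
    unfolding polyfn_def
    by (rule coord_mult_span_tensors[where \<alpha> = "\<lambda>_. 1" and \<beta> = "\<lambda>_. 0"])
      (use assms in \<open>auto simp: polyfn_def\<close>)
  then have "(\<Sum>i\<in>UNIV. (\<lambda>x. x $ i * f x)) \<in> polyfn (Suc d)"
    unfolding polyfn_def by (intro fun_vs.span_sum) auto
  moreover have "(\<Sum>i\<in>UNIV. (\<lambda>x. x $ i * f x)) = (\<lambda>x. wt x * f x)"
    by (simp add: fun_eq_iff sum_fun_apply wt_def sum_distrib_right)
  ultimately show ?thesis by simp
qed

lemma poly_wt_mult_polyfn:
  assumes "f \<in> polyfn d"
  shows "degree q \<le> e \<Longrightarrow> (\<lambda>x. poly q (wt x) * f x) \<in> polyfn (d + e)"
proof (induction q arbitrary: e)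
  case 0
  then show ?case unfolding polyfn_def
    using fun_vs.span_zero by (simp add: zero_fun_def)
next
  case (pCons a q)
  have 1: "f \<in> polyfn (d + e)" using polyfn_mono[of d "d + e"] assms by auto
  have 2: "(\<lambda>x. wt x * (poly q (wt x) * f x)) \<in> polyfn (d + e)"
  \<comment> \<open>For \<open>q = 0\<close> the polynomial \<open>pCons a q\<close> is constant, so
    \<open>e\<close> may be 0 and leave no degree for the factor \<open>wt x\<close>.\<close>
  proof (cases "q = 0")
    case True
    then show ?thesis using fun_vs.span_zero by (simp add: zero_fun_def polyfn_def)
  next
    case False
    then obtain e' where e: "e = Suc e'" using pCons.prems by (cases e) auto
    then have "(\<lambda>x. poly q (wt x) * f x) \<in> polyfn (d + e')"
      using False pCons.prems by (intro pCons.IH) simp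
    from wt_mult_polyfn[OF this] show ?thesis by (simp add: e)
  qed
  have "(\<lambda>x. poly (pCons a q) (wt x) * f x) = fun_scale a f + (\<lambda>x. wt x * (poly q (wt x) * f x))"
    by (simp add: fun_eq_iff algebra_simps)
  then show ?case using 1 2 unfolding polyfn_def by (auto intro!: fun_vs.span_add fun_vs.span_scale)
qed

text \<open>Keys may cancel in \<open>p + q\<close>; a common finite set of exponents lets
  evaluations be compared term by term.\<close>

lemma eval_rpoly_superset:
  assumes "finite S" "Poly_Mapping.keys p \<subseteq> S"
  shows "eval_rpoly p x = (\<Sum>m\<in>S. Poly_Mapping.lookup p m * tensor (\<lambda>n x. x ^ n) (Poly_Mapping.lookup m) x)"
  unfolding eval_rpoly_def tensor_def
  by (rule sum.mono_neutral_left) (use assms in \<open>auto simp: in_keys_iff\<close>)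

lemma eval_rpoly_in_polyfn:
  assumes "degree_at_most p d"
  shows "eval_rpoly p \<in> polyfn d"
proof -
  have "eval_rpoly p = (\<Sum>m\<in>Poly_Mapping.keys p. fun_scale (Poly_Mapping.lookup p m) (tensor (\<lambda>n x. x ^ n) (Poly_Mapping.lookup m)))"
    by (simp add: fun_eq_iff sum_fun_apply eval_rpoly_superset[OF finite_keys subset_refl])
  also have "\<dots> \<in> polyfn d"
    unfolding polyfn_def using assms
    by (intro fun_vs.span_sum fun_vs.span_scale fun_vs.span_base)
      (auto simp: tensors_def degree_at_most_def)
  finally show ?thesis .
qed

lemma polyfn_imp_rpoly:
  fixes f :: "real ^ 'n::finite \<Rightarrow> real"
  assumes "f \<in> polyfn d"
  obtains p where "degree_at_most p d" "f = eval_rpoly p"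
proof -
  let ?V = "{eval_rpoly p | p. degree_at_most p d} :: (real ^ 'n \<Rightarrow> real) set"
  have "fun_vs.subspace ?V"
  proof (rule fun_vs.subspaceI)
    show "0 \<in> ?V"
      by (auto intro!: exI[of _ 0] simp: degree_at_most_def eval_rpoly_def fun_eq_iff)
  next
    fix f g :: "real ^ 'n \<Rightarrow> real" assume "f \<in> ?V" "g \<in> ?V"
    then obtain p q where pq: "f = eval_rpoly p" "degree_at_most p d" "g = eval_rpoly q" "degree_at_most q d"
      by blast
    have k: "Poly_Mapping.keys (p + q) \<subseteq> Poly_Mapping.keys p \<union> Poly_Mapping.keys q" by (rule keys_add)
    then have "degree_at_most (p + q) d" using pq unfolding degree_at_most_def by blast
    moreover have "eval_rpoly (p + q) = f + g"
      using k by (simp add: fun_eq_iff pq eval_rpoly_superset[of "Poly_Mapping.keys p \<union> Poly_Mapping.keys q"] lookup_add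
          distrib_right sum.distrib)
    ultimately show "f + g \<in> ?V" by (metis (mono_tags, lifting) mem_Collect_eq)
  next
    fix r and f :: "real ^ 'n \<Rightarrow> real" assume "f \<in> ?V"
    then obtain p where p: "f = eval_rpoly p" "degree_at_most p d" by blast
    let ?q = "Poly_Mapping.map ((*) r) p"
    have k: "Poly_Mapping.keys ?q \<subseteq> Poly_Mapping.keys p" by (auto simp: in_keys_iff Poly_Mapping.map.rep_eq)
    then have "degree_at_most ?q d" using p unfolding degree_at_most_def by blast
    moreover have "eval_rpoly ?q = fun_scale r f"
      using k by (simp add: fun_eq_iff p eval_rpoly_superset[of "Poly_Mapping.keys p"] Poly_Mapping.map.rep_eq sum_distrib_left
          when_def mult.assoc in_keys_iff)
    ultimately show "fun_scale r f \<in> ?V" by (metis (mono_tags, lifting) mem_Collect_eq)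
  qed
  moreover have "tensors (\<lambda>n x. x ^ n) d \<subseteq> ?V"
  proof
    fix f :: "real ^ 'n \<Rightarrow> real" assume "f \<in> tensors (\<lambda>n x. x ^ n) d"
    then obtain m where m: "f = tensor (\<lambda>n x. x ^ n) m" "sum m UNIV \<le> d" by (auto simp: tensors_def)
    have l: "Poly_Mapping.lookup (Abs_poly_mapping m) = m" by (rule lookup_Abs_poly_mapping) simp
    let ?p = "Poly_Mapping.single (Abs_poly_mapping m) (1 :: real)"
    have "degree_at_most ?p d" using m(2) by (simp add: degree_at_most_def l)
    moreover have "eval_rpoly ?p = f"
      by (simp add: fun_eq_iff m eval_rpoly_def tensor_def l)
    ultimately show "f \<in> ?V" by (metis (mono_tags, lifting) mem_Collect_eq)
  qed
  ultimately have "polyfn d \<subseteq> ?V"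
    unfolding polyfn_def by (rule fun_vs.span_minimal[rotated])
  then show thesis using assms that by blast
qed

section \<open>Lagrange interpolation at natural nodes, and initial segments\<close>

definition lagrange :: "nat set \<Rightarrow> nat \<Rightarrow> real poly" where
  "lagrange X w = (\<Prod>u\<in>X - {w}. smult (1 / (real w - real u)) [:- real u, 1:])"

lemma poly_lagrange:
  assumes "finite X" "v \<in> X"
  shows "poly (lagrange X w) (real v) = (if v = w then 1 else 0)"
proof (cases "v = w")
  case True
  then show ?thesis by (auto simp: lagrange_def poly_prod divide_simps intro!: prod.neutral)
next
  case False
  then show ?thesis using assms unfolding lagrange_def poly_prod
    by (auto intro!: bexI[of _ v])
qed

lemma degree_lagrange:
  assumes "w \<in> X"
  shows "degree (lagrange X w) \<le> card X - 1"
proof (cases "finite X")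
  case True
  have "degree (lagrange X w) \<le> (\<Sum>u\<in>X - {w}. degree (smult (1 / (real w - real u)) [:- real u, 1:]))"
    unfolding lagrange_def using degree_prod_sum_le[OF finite_Diff[OF True]] unfolding o_def .
  also have "\<dots> \<le> (\<Sum>u\<in>X - {w}. 1)" by (intro sum_mono) simp
  finally show ?thesis using True assms by simp
qed (simp add: lagrange_def)

lemma lagrange_interpolation:
  assumes "finite X" "degree g < card X"
  shows "poly g y = (\<Sum>w\<in>X. poly g (real w) * poly (lagrange X w) y)"
proof -
  let ?h = "\<Sum>w\<in>X. smult (poly g (real w)) (lagrange X w)"
  have "g = ?h"
  proof (rule poly_eqI_degree[of "real ` X"])
    fix x assume "x \<in> real ` X"
    then obtain v where v: "x = real v" "v \<in> X" by blast
    have "poly ?h x = (\<Sum>w\<in>X. if v = w then poly g (real w) else 0)"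
      unfolding v(1) poly_sum poly_smult poly_lagrange[OF assms(1) v(2)] by (intro sum.cong) auto
    then show "poly g x = poly ?h x" using assms(1) v by simp
  next
    have c: "card (real ` X) = card X" by (rule card_image) simp
    then show "degree g < card (real ` X)" using assms(2) by simp
    have "degree ?h \<le> card X - 1"
      by (intro degree_sum_le assms(1) order.trans[OF degree_smult_le] degree_lagrange)
    then show "degree ?h < card (real ` X)" using assms(2) c by linarith
  qed
  then have "poly g y = poly ?h y" by simp
  then show ?thesis by (simp add: poly_sum)
qed

text \<open>Isolates what the monotonicity of \<open>t\<close> and \<open>w\<close> is needed for:
  the indices \<open>i\<close> with \<open>j \<le> t i\<close>, and those with
  \<open>w i + j \<le> rk\<close>, are downward closed.\<close>

lemma initial_segment_eq:
  fixes S :: "nat set"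
  assumes "S \<subseteq> {1..r}" "\<And>i i'. i \<in> S \<Longrightarrow> 1 \<le> i' \<Longrightarrow> i' \<le> i \<Longrightarrow> i' \<in> S"
  shows "S = {1..card S}"
proof (cases "S = {}")
  case False
  have fin: "finite S" using assms(1) finite_subset by blast
  have "S = {1..Max S}"
  proof
    show "S \<subseteq> {1..Max S}" using assms(1) fin by auto
    show "{1..Max S} \<subseteq> S" using assms(2) Max_in[OF fin False] by auto
  qed
  then show ?thesis by (metis card_atLeastAtMost diff_Suc_1)
qed simp

section \<open>The sl2-action on a product of chains\<close>

text \<open>\<open>K i\<close> is the top of chain \<open>i\<close>. The algebra runs over vectors
  of naturals; \<open>point\<close> carries them to the real grid only where polynomials are
  evaluated.\<close>

locale chain_product =
  fixes K :: "'n::finite \<Rightarrow> nat"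
begin

definition pts :: "('n \<Rightarrow> nat) set" where
  "pts = {a. \<forall>i. a i \<le> K i}"

definition level :: "nat \<Rightarrow> ('n \<Rightarrow> nat) set" where
  "level m = {a \<in> pts. sum a UNIV = m}"

definition rk :: nat where "rk = sum K UNIV"

text \<open>The coefficient \<open>x i\<close> is 0 where \<open>x i - 1\<close> is truncated, and \<open>K i - x i\<close> is 0 where
  \<open>x i + 1\<close> leaves the grid. These are the actions of the two nilpotent generators of sl2 on a
  tensor product of irreducible representations of dimensions \<open>K i + 1\<close>, in the divided power
  bases.\<close>

definition raise :: "(('n \<Rightarrow> nat) \<Rightarrow> real) \<Rightarrow> ('n \<Rightarrow> nat) \<Rightarrow> real" where
  "raise v x = (if x \<in> pts then \<Sum>i\<in>UNIV. real (x i) * v (x(i := x i - 1)) else 0)"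

definition lower :: "(('n \<Rightarrow> nat) \<Rightarrow> real) \<Rightarrow> ('n \<Rightarrow> nat) \<Rightarrow> real" where
  "lower v x = (if x \<in> pts then \<Sum>i\<in>UNIV. real (K i - x i) * v (x(i := x i + 1)) else 0)"

lemma finite_pts: "finite pts"
proof -
  have "pts = (\<Pi>\<^sub>E i\<in>UNIV. {..K i})" by (auto simp: pts_def PiE_def extensional_def)
  then show ?thesis by (simp add: finite_PiE)
qed

lemma finite_level: "finite (level m)"
  using finite_pts by (simp add: level_def)

lemma member_le_sum_UNIV: "x i \<le> sum x UNIV" for x :: "'n \<Rightarrow> nat"
  by (rule member_le_sum) auto

lemma linear_raise: "Vector_Spaces.linear fun_scale fun_scale raise"
  unfolding Vector_Spaces.linear_iff
  by (auto simp: fun_vs.vector_space_axioms raise_def fun_eq_iff sum.distrib distrib_left sum_distrib_left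
      mult_ac)

lemma linear_lower: "Vector_Spaces.linear fun_scale fun_scale lower"
  unfolding Vector_Spaces.linear_iff
  by (auto simp: fun_vs.vector_space_axioms lower_def fun_eq_iff sum.distrib distrib_left sum_distrib_left
      mult_ac)

lemma raise_level:
  assumes "v \<in> fun_space (level m)"
  shows "raise v \<in> fun_space (level (Suc m))"
proof -
  have "raise v x = 0" if x: "x \<notin> level (Suc m)" for x
  proof (cases "x \<in> pts")
    case True
    have "real (x i) * v (x(i := x i - 1)) = 0" for i
    proof (cases "x i = 0")
      case False
      then have "x(i := x i - 1) \<notin> level m"
        using x True member_le_sum_UNIV[of x i] sum_fun_upd[of x i "x i - 1"]
        by (auto simp: level_def simp del: fun_upd_apply)
      then show ?thesis using assms by (simp add: fun_space_def)
    qed simp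
    then show ?thesis unfolding raise_def by (simp only: sum.neutral_const if_cancel)
  qed (simp add: raise_def)
  then show ?thesis by (simp add: fun_space_def)
qed

text \<open>With truncated subtraction the first claim for \<open>m = 0\<close> only places
  \<open>lower v\<close> in level 0; the second one adds that it vanishes, as no point of level 0
  lies above another point.\<close>

lemma lower_level:
  assumes "v \<in> fun_space (level m)"
  shows "lower v \<in> fun_space (level (m - 1))" "m = 0 \<Longrightarrow> lower v = 0"
proof -
  have *: "lower v x = 0" if x: "x \<notin> level (m - 1) \<or> m = 0" for x
  proof (cases "x \<in> pts")
    case True
    have "real (K i - x i) * v (x(i := x i + 1)) = 0" for i
    proof -
      have "x(i := x i + 1) \<notin> level m"
        using x True member_le_sum_UNIV[of x i] sum_fun_upd[of x i "x i + 1"]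
        by (auto simp: level_def simp del: fun_upd_apply)
      then show ?thesis using assms by (simp add: fun_space_def)
    qed
    then show ?thesis unfolding lower_def by (simp only: sum.neutral_const if_cancel)
  qed (simp add: lower_def)
  show "lower v \<in> fun_space (level (m - 1))" using * by (simp add: fun_space_def)
  show "lower v = 0" if "m = 0" using * that by (simp add: fun_eq_iff)
qed

text \<open>Shifts in different coordinates commute, so the off-diagonal terms of the two double
  sums cancel. Coordinate i leaves (K_i - x_i)(x_i + 1) - x_i (K_i - x_i + 1) = K_i - 2 x_i, and
  these add up to \<open>rk - 2 * m\<close>.\<close>

lemma lower_raise:
  assumes v: "v \<in> fun_space (level m)"
  shows "lower (raise v) = raise (lower v) + fun_scale (real rk - 2 * real m) v"
proof
  fix x
  show "lower (raise v) x = (raise (lower v) + fun_scale (real rk - 2 * real m) v) x"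
  proof (cases "x \<in> pts")
    case False
    then have "v x = 0" using v by (auto simp: fun_space_def level_def)
    then show ?thesis using False by (simp add: lower_def raise_def)
  next
    case True
    let ?P = "\<lambda>i l. real (K i - x i) * (real ((x(i := x i + 1)) l) *
                 v ((x(i := x i + 1))(l := (x(i := x i + 1)) l - 1)))"
    let ?Q = "\<lambda>i l. real (x l) * (real (K i - (x(l := x l - 1)) i) *
                 v ((x(l := x l - 1))(i := (x(l := x l - 1)) i + 1)))"
    have "lower (raise v) x = (\<Sum>i\<in>UNIV. real (K i - x i) * raise v (x(i := x i + 1)))"
      using True by (simp add: lower_def)
    also have "\<dots> = (\<Sum>i\<in>UNIV. \<Sum>l\<in>UNIV. ?P i l)"
    proof (rule sum.cong[OF refl])
      fix i
      show "real (K i - x i) * raise v (x(i := x i + 1)) = (\<Sum>l\<in>UNIV. ?P i l)"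
      \<comment> \<open>For \<open>x i = K i\<close> the shifted point leaves \<open>pts\<close>,
        where \<open>raise\<close> does not unfold to its sum; the coefficient
        \<open>K i - x i\<close> is 0 on both sides.\<close>
      proof (cases "x i = K i")
        case False
        then have "x i < K i" using True by (auto simp: pts_def le_less)
        then have "x(i := x i + 1) \<in> pts" using True by (auto simp: pts_def)
        then show ?thesis by (simp add: raise_def sum_distrib_left)
      qed simp
    qed
    finally have 1: "lower (raise v) x = (\<Sum>i\<in>UNIV. \<Sum>l\<in>UNIV. ?P i l)" .
    have "raise (lower v) x = (\<Sum>l\<in>UNIV. real (x l) * lower v (x(l := x l - 1)))"
      using True by (simp add: raise_def)
    also have "\<dots> = (\<Sum>l\<in>UNIV. \<Sum>i\<in>UNIV. ?Q i l)"
    proof (rule sum.cong[OF refl])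
      fix l
      have "x(l := x l - 1) \<in> pts"
        using True unfolding pts_def by (auto intro: order.trans[OF diff_le_self])
      then show "real (x l) * lower v (x(l := x l - 1)) = (\<Sum>i\<in>UNIV. ?Q i l)"
        by (simp add: lower_def sum_distrib_left)
    qed
    also have "\<dots> = (\<Sum>i\<in>UNIV. \<Sum>l\<in>UNIV. ?Q i l)" by (rule sum.swap)
    finally have 2: "raise (lower v) x = (\<Sum>i\<in>UNIV. \<Sum>l\<in>UNIV. ?Q i l)" .
    have d: "?P i l - ?Q i l = (if l = i then (real (K i) - 2 * real (x i)) * v x else 0)" for i l
    proof (cases "l = i")
      case True
      have le: "x i \<le> K i" using \<open>x \<in> pts\<close> by (simp add: pts_def)
      show ?thesis
      \<comment> \<open>At \<open>x i = 0\<close> the truncated \<open>x i - 1\<close> is not undone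
        by the upward shift, but its coefficient \<open>real (x i)\<close> is 0.\<close>
      proof (cases "x i = 0")
        case xi: True
        then show ?thesis using True by (simp add: fun_upd_idem)
      next
        case False
        then have "real (K i - (x i - 1)) = real (K i) - real (x i) + 1" using le by linarith
        moreover have "real (K i - x i) = real (K i) - real (x i)" using le by linarith
        ultimately show ?thesis using True False
          by (simp add: fun_upd_idem) (simp add: algebra_simps)
      qed
    next
      case False
      then show ?thesis by (simp add: fun_upd_twist)
    qed
    have "lower (raise v) x - raise (lower v) x = (\<Sum>i\<in>UNIV. \<Sum>l\<in>UNIV. ?P i l - ?Q i l)"
      by (simp only: 1 2 sum_subtractf)
    also have "\<dots> = (\<Sum>i\<in>UNIV. (real (K i) - 2 * real (x i)) * v x)"
      by (simp only: d) simp
    also have "\<dots> = (real rk - 2 * real (sum x UNIV)) * v x"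
      by (simp add: rk_def sum_subtractf sum_distrib_left flip: sum_distrib_right)
    also have "\<dots> = (real rk - 2 * real m) * v x"
      using v by (cases "x \<in> level m") (auto simp: level_def fun_space_def)
    finally show ?thesis by simp
  qed
qed

section \<open>A positive inner product making raise and lower adjoint\<close>

definition weight :: "('n \<Rightarrow> nat) \<Rightarrow> real" where
  "weight x = (\<Prod>i\<in>UNIV. real (K i choose x i))"

definition ip :: "(('n \<Rightarrow> nat) \<Rightarrow> real) \<Rightarrow> (('n \<Rightarrow> nat) \<Rightarrow> real) \<Rightarrow> real" where
  "ip u v = (\<Sum>x\<in>pts. weight x * u x * v x)"

lemma weight_pos: "x \<in> pts \<Longrightarrow> weight x > 0"
  unfolding weight_def by (intro prod_pos) (auto simp: pts_def)

lemma ip_nonneg: "ip u u \<ge> 0"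
  unfolding ip_def using weight_pos by (intro sum_nonneg) (simp add: mult.assoc less_imp_le)

lemma ip_zeroD:
  assumes "ip u u = 0" "u \<in> fun_space (level m)"
  shows "u = 0"
proof
  fix x
  show "u x = 0 x"
  proof (cases "x \<in> pts")
    case True
    have "weight x * u x * u x = 0"
    proof -
      have "\<forall>x\<in>pts. weight x * u x * u x = 0"
        using assms(1) weight_pos unfolding ip_def
        by (subst (asm) sum_nonneg_eq_0_iff) (auto simp: finite_pts mult.assoc less_imp_le)
      then show ?thesis using True by blast
    qed
    then show ?thesis using weight_pos[OF True] by simp
  qed (use assms(2) in \<open>auto simp: fun_space_def level_def\<close>)
qed

text \<open>In one chain this is (a + 1) C(K, a + 1) = (K - a) C(K, a). It is the ratio that
  adjointness demands of neighbouring points, hence the origin of the binomials in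
  \<open>weight\<close>.\<close>

lemma weight_step:
  assumes "x i < K i"
  shows "weight (x(i := x i + 1)) * (real (x i) + 1) = weight x * (real (K i) - real (x i))"
proof -
  have w: "weight y = real (K i choose y i) * (\<Prod>l\<in>UNIV - {i}. real (K l choose y l))" for y
    unfolding weight_def by (simp add: prod.remove)
  have "(\<Prod>l\<in>UNIV - {i}. real (K l choose (x(i := x i + 1)) l)) = (\<Prod>l\<in>UNIV - {i}. real (K l choose x l))"
    by (intro prod.cong) auto
  moreover have "(K i choose (x i + 1)) * (x i + 1) = (K i choose x i) * (K i - x i)"
    using binomial_absorb_comp[of "K i" "x i"] binomial_absorption[of "x i" "K i"]
    by (metis Suc_eq_plus1 mult.commute)
  then have "real (K i choose (x i + 1)) * (real (x i) + 1) = real (K i choose x i) * (real (K i) - real (x i))"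
    using assms by (metis (no_types, lifting) less_imp_le of_nat_1 of_nat_add of_nat_diff of_nat_mult)
  ultimately show ?thesis unfolding w[of x] w[of "x(i := x i + 1)"] by simp
qed

text \<open>For each coordinate i, substitute x = y + e_i, a bijection from the points with
  \<open>y i < K i\<close> to those with \<open>x i > 0\<close>. All other points carry coefficient
  0, and \<open>weight_step\<close> matches the coefficients.\<close>

lemma ip_raise: "ip (raise u) v = ip u (lower v)"
proof -
  have "ip (raise u) v = (\<Sum>x\<in>pts. \<Sum>i\<in>UNIV. weight x * real (x i) * u (x(i := x i - 1)) * v x)"
    unfolding ip_def by (intro sum.cong) (auto simp: raise_def sum_distrib_left sum_distrib_right mult_ac)
  also have "\<dots> = (\<Sum>i\<in>UNIV. \<Sum>x\<in>pts. weight x * real (x i) * u (x(i := x i - 1)) * v x)"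
    by (rule sum.swap)
  also have "\<dots> = (\<Sum>i\<in>UNIV. \<Sum>y\<in>pts. weight y * real (K i - y i) * u y * v (y(i := y i + 1)))"
  proof (rule sum.cong[OF refl])
    fix i
    have "(\<Sum>x\<in>pts. weight x * real (x i) * u (x(i := x i - 1)) * v x)
        = (\<Sum>x\<in>{x \<in> pts. x i > 0}. weight x * real (x i) * u (x(i := x i - 1)) * v x)"
      by (rule sum.mono_neutral_right) (auto simp: finite_pts)
    also have "\<dots> = (\<Sum>y\<in>{y \<in> pts. y i < K i}. weight y * real (K i - y i) * u y * v (y(i := y i + 1)))"
    proof (rule sum.reindex_bij_witness[of _ "\<lambda>y. y(i := y i + 1)" "\<lambda>x. x(i := x i - 1)"])
      fix x assume "x \<in> {x \<in> pts. 0 < x i}"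
      then have x: "x \<in> pts" "0 < x i" by auto
      show "(x(i := x i - 1))(i := (x(i := x i - 1)) i + 1) = x" using x by (auto simp: fun_upd_idem)
      have le: "x i \<le> K i" using x by (auto simp: pts_def)
      show "x(i := x i - 1) \<in> {y \<in> pts. y i < K i}"
        using x le unfolding pts_def
        by (auto intro: order.trans[OF diff_le_self] less_le_trans[OF diff_less])
      have "weight x * real (x i) = weight (x(i := x i - 1)) * (real (K i) - real (x i) + 1)"
        using weight_step[of "x(i := x i - 1)" i] x le by (simp add: fun_upd_idem of_nat_diff)
      then show "weight (x(i := x i - 1)) * real (K i - (x(i := x i - 1)) i) * u (x(i := x i - 1)) *
          v ((x(i := x i - 1))(i := (x(i := x i - 1)) i + 1)) =
          weight x * real (x i) * u (x(i := x i - 1)) * v x"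
        using x le by (simp add: fun_upd_idem of_nat_diff)
    next
      fix y assume "y \<in> {y \<in> pts. y i < K i}"
      then have y: "y \<in> pts" "y i < K i" by auto
      then show "(y(i := y i + 1))(i := (y(i := y i + 1)) i - 1) = y" by auto
      show "y(i := y i + 1) \<in> {x \<in> pts. 0 < x i}" using y by (auto simp: pts_def)
    qed
    also have "\<dots> = (\<Sum>y\<in>pts. weight y * real (K i - y i) * u y * v (y(i := y i + 1)))"
    proof (rule sum.mono_neutral_left[OF finite_pts])
      have "y i = K i" if "y \<in> pts" "\<not> y i < K i" for y
        using that unfolding pts_def by (auto intro: antisym)
      then show "\<forall>y\<in>pts - {y \<in> pts. y i < K i}. weight y * real (K i - y i) * u y * v (y(i := y i + 1)) = 0"
        by auto
    qed auto
    finally show "(\<Sum>x\<in>pts. weight x * real (x i) * u (x(i := x i - 1)) * v x)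
      = (\<Sum>y\<in>pts. weight y * real (K i - y i) * u y * v (y(i := y i + 1)))" .
  qed
  also have "\<dots> = (\<Sum>y\<in>pts. \<Sum>i\<in>UNIV. weight y * real (K i - y i) * u y * v (y(i := y i + 1)))"
    by (rule sum.swap)
  also have "\<dots> = ip u (lower v)"
    unfolding ip_def by (intro sum.cong) (auto simp: lower_def sum_distrib_left mult_ac)
  finally show ?thesis .
qed

lemma ip_commute: "ip u v = ip v u"
  by (simp add: ip_def mult_ac)

lemma ip_add_right: "ip u (v + w) = ip u v + ip u w"
  by (simp add: ip_def distrib_left sum.distrib)

lemma ip_scale_right: "ip u (fun_scale c v) = c * ip u v"
  by (simp add: ip_def sum_distrib_left mult_ac)

text \<open>The commutation relation read as an identity of norms. The sign of
  \<open>rk - 2 * m\<close> decides what it yields: a positive one makes \<open>raise\<close>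
  injective on the level, a negative one makes \<open>lower\<close> injective.\<close>

lemma ip_raise_raise:
  assumes "u \<in> fun_space (level m)"
  shows "ip (raise u) (raise u) = ip (lower u) (lower u) + (real rk - 2 * real m) * ip u u"
proof -
  have "ip (raise u) (raise u) = ip u (raise (lower u)) + (real rk - 2 * real m) * ip u u"
    by (simp add: ip_raise lower_raise[OF assms] ip_add_right ip_scale_right)
  then show ?thesis using ip_raise[of "lower u" u] by (simp add: ip_commute)
qed

lemma ip_zero [simp]: "ip 0 u = 0" "ip u 0 = 0"
  by (simp_all add: ip_def)

lemma raise_zero [simp]: "raise 0 = 0" and lower_zero [simp]: "lower 0 = 0"
  by (simp_all add: raise_def lower_def fun_eq_iff)

lemma raise_eq_0D:
  assumes "u \<in> fun_space (level m)" "raise u = 0" "2 * m < rk"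
  shows "u = 0"
proof -
  have "0 = ip (lower u) (lower u) + (real rk - 2 * real m) * ip u u"
    using ip_raise_raise[OF assms(1)] assms(2) by simp
  moreover have "real rk - 2 * real m > 0" using assms(3) by linarith
  ultimately have "(real rk - 2 * real m) * ip u u \<le> 0"
    using ip_nonneg[of "lower u"] by linarith
  then have "ip u u = 0"
    using \<open>real rk - 2 * real m > 0\<close> ip_nonneg[of u] by (simp add: mult_le_0_iff)
  then show ?thesis using ip_zeroD assms(1) by blast
qed

lemma lower_eq_0D:
  assumes "u \<in> fun_space (level m)" "lower u = 0" "2 * m > rk"
  shows "u = 0"
proof -
  have "ip (raise u) (raise u) = (real rk - 2 * real m) * ip u u"
    using ip_raise_raise[OF assms(1)] assms(2) by simp
  moreover have n: "real rk - 2 * real m < 0" using assms(3) by linarith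
  ultimately have "(real rk - 2 * real m) * ip u u \<ge> 0"
    using ip_nonneg[of "raise u"] by linarith
  then have "ip u u = 0"
    using n ip_nonneg[of u] by (simp add: zero_le_mult_iff)
  then show ?thesis using ip_zeroD assms(1) by blast
qed

lemma linear_lower_raise: "Vector_Spaces.linear fun_scale fun_scale (\<lambda>v. lower (raise v))"
  using Vector_Spaces.linear_compose[OF linear_raise linear_lower] by (simp add: o_def)

lemma linear_raise_lower: "Vector_Spaces.linear fun_scale fun_scale (\<lambda>v. raise (lower v))"
  using Vector_Spaces.linear_compose[OF linear_lower linear_raise] by (simp add: o_def)

text \<open>Below the middle, \<open>lower \<circ> raise\<close> is injective, hence bijective, on level \<open>m\<close>; from the
  middle on, \<open>raise \<circ> lower\<close> is so on level \<open>Suc m\<close>.\<close>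

lemma level_split:
  assumes v: "v \<in> fun_space (level (Suc m))"
  obtains u where "u \<in> fun_space (level m)" "lower (v - raise u) = 0"
proof (cases "2 * m < rk")
  case True
  have "u = 0" if u: "u \<in> fun_space (level m)" "lower (raise u) = 0" for u
  proof -
    have "ip (raise u) (raise u) = 0" using u(2) by (simp add: ip_raise)
    then have "raise u = 0" using ip_zeroD raise_level[OF u(1)] by blast
    then show ?thesis using raise_eq_0D u(1) True by blast
  qed
  moreover have "lower (raise u) \<in> fun_space (level m)" if "u \<in> fun_space (level m)" for u
    using lower_level(1)[OF raise_level[OF that]] by simp
  moreover have "lower v \<in> fun_space (level m)" using lower_level(1)[OF v] by simp
  ultimately obtain u where "u \<in> fun_space (level m)" "lower (raise u) = lower v"
    using linear_inj_imp_surj_fun_space[OF finite_level linear_lower_raise] by blast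
  then show thesis
    using that fun_vs_pair.linear_diff[OF linear_lower] by simp
next
  case False
  have "u = 0" if u: "u \<in> fun_space (level (Suc m))" "raise (lower u) = 0" for u
  proof -
    have "ip (lower u) (lower u) = 0" using u(2) ip_raise[of "lower u" u] by simp
    then have "lower u = 0" using ip_zeroD lower_level(1)[OF u(1)] by blast
    then show ?thesis using lower_eq_0D u(1) False by simp
  qed
  moreover have lev: "lower u \<in> fun_space (level m)" if "u \<in> fun_space (level (Suc m))" for u
    using lower_level(1)[OF that] by simp
  then have "raise (lower u) \<in> fun_space (level (Suc m))" if "u \<in> fun_space (level (Suc m))" for u
    using raise_level that by blast
  ultimately obtain u where "u \<in> fun_space (level (Suc m))" "raise (lower u) = v"
    using linear_inj_imp_surj_fun_space[OF finite_level linear_raise_lower _ _ v] by blast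
  \<comment> \<open>Here the correction \<open>lower u\<close> leaves the difference 0: above the
    middle no nonzero primitive vector exists.\<close>
  then show thesis using that[of "lower u"] lev by simp
qed

section \<open>Primitive vectors and the strings above them\<close>

definition primitive :: "nat \<Rightarrow> (('n \<Rightarrow> nat) \<Rightarrow> real) set" where
  "primitive j = {v \<in> fun_space (level j). lower v = 0}"

definition prim_basis :: "nat \<Rightarrow> (('n \<Rightarrow> nat) \<Rightarrow> real) set" where
  "prim_basis j = (SOME B. B \<subseteq> primitive j \<and> fun_vs.independent B \<and> primitive j \<subseteq> fun_vs.span B)"

lemma prim_basis:
  "prim_basis j \<subseteq> primitive j" "fun_vs.independent (prim_basis j)"
  "primitive j \<subseteq> fun_vs.span (prim_basis j)"
proof -
  have "\<exists>B. B \<subseteq> primitive j \<and> fun_vs.independent B \<and> primitive j \<subseteq> fun_vs.span B"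
    by (meson fun_vs.maximal_independent_subset)
  from someI_ex[OF this]
  show "prim_basis j \<subseteq> primitive j" "fun_vs.independent (prim_basis j)"
    "primitive j \<subseteq> fun_vs.span (prim_basis j)"
    unfolding prim_basis_def by blast+
qed

lemma finite_prim_basis: "finite (prim_basis j)"
  using finite_independent_fun_space[OF finite_level prim_basis(2)] prim_basis(1)
  by (auto simp: primitive_def)

lemma prim_basisD:
  assumes "b \<in> prim_basis j"
  shows "b \<in> fun_space (level j)" "lower b = 0"
  using assms prim_basis(1) by (auto simp: primitive_def)

lemma raise_pow_level: "v \<in> fun_space (level m) \<Longrightarrow> (raise ^^ s) v \<in> fun_space (level (m + s))"
  by (induction s) (auto intro: raise_level)

lemma linear_raise_pow: "Vector_Spaces.linear fun_scale fun_scale (raise ^^ s)"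
proof (induction s)
  case 0
  show ?case unfolding funpow.simps(1) by (rule fun_vs.linear_id)
next
  case (Suc s)
  show ?case unfolding funpow.simps(2) by (rule Vector_Spaces.linear_compose[OF Suc linear_raise])
qed

lemma linear_lower_pow: "Vector_Spaces.linear fun_scale fun_scale (lower ^^ s)"
proof (induction s)
  case 0
  show ?case unfolding funpow.simps(1) by (rule fun_vs.linear_id)
next
  case (Suc s)
  show ?case unfolding funpow.simps(2) by (rule Vector_Spaces.linear_compose[OF Suc linear_lower])
qed

text \<open>Moving \<open>lower\<close> past the \<open>Suc s\<close> copies of \<open>raise\<close>
  collects the terms rk - 2(j + i) for i = 0, ..., s; their sum is the constant.\<close>

lemma lower_raise_pow:
  assumes "b \<in> prim_basis j"
  shows "lower ((raise ^^ Suc s) b)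
    = fun_scale (real (Suc s) * (real rk - 2 * real j - real s)) ((raise ^^ s) b)"
proof (induction s)
  case 0
  show ?case using lower_raise[OF prim_basisD(1)[OF assms]] prim_basisD(2)[OF assms] by simp
next
  case (Suc s)
  let ?c = "real (Suc s) * (real rk - 2 * real j - real s)"
  let ?u = "(raise ^^ Suc s) b"
  have "lower ((raise ^^ Suc (Suc s)) b) = lower (raise ?u)" by simp
  also have "\<dots> = raise (lower ?u) + fun_scale (real rk - 2 * real (j + Suc s)) ?u"
    by (rule lower_raise[OF raise_pow_level[OF prim_basisD(1)[OF assms]]])
  also have "raise (lower ?u) = fun_scale ?c ?u"
    unfolding Suc.IH fun_vs_pair.linear_scale[OF linear_raise] by simp
  also have "fun_scale ?c ?u + fun_scale (real rk - 2 * real (j + Suc s)) ?u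
     = fun_scale (?c + (real rk - 2 * real (j + Suc s))) ?u"
    by (simp add: fun_vs.scale_left_distrib)
  also have "?c + (real rk - 2 * real (j + Suc s)) = real (Suc (Suc s)) * (real rk - 2 * real j - real (Suc s))"
    by (simp add: algebra_simps)
  finally show ?case .
qed

text \<open>With q = rk - 2j the constant of \<open>lower_raise_pow\<close> is 0 at s = q, so
  \<open>lower\<close> kills the vector at level rk - j + 1. That level is above the middle, where
  \<open>lower\<close> is injective. If already 2j > rk, the same argument gives b = 0.\<close>

lemma prim_basis_top:
  assumes "b \<in> prim_basis j" "rk < 2 * j + s"
  shows "(raise ^^ s) b = 0"
proof -
  have b: "b \<in> fun_space (level j)" "lower b = 0" using prim_basisD[OF assms(1)] .
  show ?thesis
  proof (cases "rk < 2 * j")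
    case True
    then have "b = 0" using lower_eq_0D b by blast
    then show ?thesis using fun_vs_pair.linear_0[OF linear_raise_pow] by simp
  next
    case False
    define q where "q = rk - 2 * j"
    have q: "real rk - 2 * real j - real q = 0" using False by (simp add: q_def of_nat_diff)
    have "lower ((raise ^^ Suc q) b) = 0"
      unfolding lower_raise_pow[OF assms(1)] q by (simp add: fun_eq_iff)
    then have z: "(raise ^^ Suc q) b = 0"
      by (rule lower_eq_0D[OF raise_pow_level[OF b(1)]]) (use False in \<open>simp add: q_def\<close>)
    have "s = (s - Suc q) + Suc q" using assms(2) False unfolding q_def by linarith
    then have "(raise ^^ s) b = (raise ^^ (s - Suc q)) ((raise ^^ Suc q) b)"
      by (metis funpow_add comp_apply)
    then show ?thesis using z fun_vs_pair.linear_0[OF linear_raise_pow] by simp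
  qed
qed

lemma lower_pow_raise_pow:
  assumes b: "b \<in> prim_basis j"
  shows "(lower ^^ s) ((raise ^^ s) b) = fun_scale (\<Prod>i<s. real (Suc i) * (real rk - 2 * real j - real i)) b"
proof (induction s)
  case (Suc s)
  have "(lower ^^ Suc s) ((raise ^^ Suc s) b) = (lower ^^ s) (lower ((raise ^^ Suc s) b))"
    by (simp add: funpow_swap1)
  also have "\<dots> = fun_scale (real (Suc s) * (real rk - 2 * real j - real s)) ((lower ^^ s) ((raise ^^ s) b))"
    unfolding lower_raise_pow[OF b] fun_vs_pair.linear_scale[OF linear_lower_pow] ..
  finally show ?case unfolding Suc.IH by (simp add: mult_ac)
qed simp

lemma lower_pow_raise_pow_0:
  assumes b: "b \<in> prim_basis j" and "s < t"
  shows "(lower ^^ t) ((raise ^^ s) b) = 0"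
proof -
  have "t = (t - Suc s) + Suc s" using assms(2) by simp
  then have "(lower ^^ t) ((raise ^^ s) b) = (lower ^^ (t - Suc s)) ((lower ^^ Suc s) ((raise ^^ s) b))"
    by (metis funpow_add comp_apply)
  moreover have "(lower ^^ Suc s) ((raise ^^ s) b) = 0"
    by (simp add: lower_pow_raise_pow[OF b] fun_vs_pair.linear_scale[OF linear_lower] prim_basisD(2)[OF b])
  ultimately show ?thesis using fun_vs_pair.linear_0[OF linear_lower_pow] by simp
qed

text \<open>The strings that meet level \<open>m\<close>: by \<open>prim_basis_top\<close>, a string
  starting in level j lives only on levels j, ..., rk - j.\<close>

definition strings :: "nat \<Rightarrow> (nat \<times> (('n \<Rightarrow> nat) \<Rightarrow> real)) set" where
  "strings m = (SIGMA j:{j. j \<le> m \<and> m + j \<le> rk}. prim_basis j)"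

definition string_vec :: "nat \<Rightarrow> nat \<times> (('n \<Rightarrow> nat) \<Rightarrow> real) \<Rightarrow> ('n \<Rightarrow> nat) \<Rightarrow> real" where
  "string_vec m = (\<lambda>(j, b). (raise ^^ (m - j)) b)"

lemma finite_strings: "finite (strings m)"
  unfolding strings_def
  by (intro finite_SigmaI finite_prim_basis) (auto intro: finite_subset[of _ "{..m}"])

lemma string_vec_coeffs_zero:
  assumes z: "\<And>x. (\<Sum>p\<in>strings m. c p * string_vec m p x) = 0" and p: "p \<in> strings m"
  shows "c p = 0"
proof -
  have zero: "(\<Sum>p\<in>strings m. fun_scale (c p) (string_vec m p)) = 0"
    using z by (simp add: fun_eq_iff sum_fun_apply)
  have "\<forall>b\<in>prim_basis j. c (j, b) = 0" if "j \<le> m" "m + j \<le> rk" for j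
    using that
  proof (induction j rule: less_induct)
    case (less j)
    define C where "C = (\<Prod>i<m - j. real (Suc i) * (real rk - 2 * real j - real i))"
    \<comment> \<open>Each factor is positive because i < m - j \<le> rk - 2j.\<close>
    have "C > 0" unfolding C_def using less.prems by (intro prod_pos) auto
    \<comment> \<open>\<open>lower ^^ (m - j)\<close> kills the strings starting above \<open>j\<close>; below \<open>j\<close> the induction applies.\<close>
    have contr: "c p * (lower ^^ (m - j)) (string_vec m p) x
        = (if p \<in> Pair j ` prim_basis j then C * (c p * snd p x) else 0)"
      if p: "p \<in> strings m" for p x
    proof -
      obtain i b where ib: "p = (i, b)" "i \<le> m" "m + i \<le> rk" "b \<in> prim_basis i"
        using p by (auto simp: strings_def)
      consider "i < j" | "i = j" | "i > j" by linarith
      then show ?thesis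
      proof cases
        case 1
        then show ?thesis using less.IH[of i] ib by auto
      next
        case 2
        then show ?thesis using ib lower_pow_raise_pow[of b j "m - j"]
          by (auto simp: string_vec_def C_def)
      next
        case 3
        then have "(lower ^^ (m - j)) ((raise ^^ (m - i)) b) = 0"
          using ib less.prems by (intro lower_pow_raise_pow_0[of b i]) auto
        then show ?thesis using ib 3 by (auto simp: string_vec_def)
      qed
    qed
    have sub: "Pair j ` prim_basis j \<subseteq> strings m" using less.prems by (auto simp: strings_def)
    have "(\<Sum>b\<in>prim_basis j. c (j, b) * b x) = 0" for x
    proof -
      have "0 = (lower ^^ (m - j)) (\<Sum>p\<in>strings m. fun_scale (c p) (string_vec m p)) x"
        by (simp add: zero fun_vs_pair.linear_0[OF linear_lower_pow])
      also have "\<dots> = (\<Sum>p\<in>strings m. c p * (lower ^^ (m - j)) (string_vec m p) x)"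
        by (simp add: fun_vs_pair.linear_sum[OF linear_lower_pow] fun_vs_pair.linear_scale[OF linear_lower_pow]
            sum_fun_apply)
      also have "\<dots> = (\<Sum>p\<in>strings m. if p \<in> Pair j ` prim_basis j then C * (c p * snd p x) else 0)"
        by (rule sum.cong[OF refl contr])
      also have "\<dots> = (\<Sum>p\<in>Pair j ` prim_basis j. C * (c p * snd p x))"
        using sub by (simp add: sum.If_cases finite_strings Int_absorb1)
      also have "\<dots> = C * (\<Sum>b\<in>prim_basis j. c (j, b) * b x)"
        by (simp add: sum.reindex inj_on_def sum_distrib_left)
      finally show ?thesis using \<open>C > 0\<close> by simp
    qed
    then show ?case
      using independent_coeffs_zero[OF prim_basis(2) finite_prim_basis, of "\<lambda>b. c (j, b)"] by blast
  qed
  then show ?thesis using p by (auto simp: strings_def)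
qed

lemma level_subset_span_strings:
  "fun_space (level m) \<subseteq> fun_vs.span (string_vec m ` (SIGMA j:{..m}. prim_basis j))"
proof (induction m)
  case 0
  have "v \<in> primitive 0" if "v \<in> fun_space (level 0)" for v
    using that lower_level(2)[OF that] by (simp add: primitive_def)
  then have "fun_space (level 0) \<subseteq> fun_vs.span (prim_basis 0)"
    using prim_basis(3) by blast
  moreover have "prim_basis 0 \<subseteq> string_vec 0 ` (SIGMA j:{..0}. prim_basis j)"
    by (force simp: string_vec_def)
  ultimately show ?case using fun_vs.span_mono by blast
next
  case (Suc m)
  let ?S = "\<lambda>m. string_vec m ` (SIGMA j:{..m}. prim_basis j)"
  show ?case
  proof
    fix v assume v: "v \<in> fun_space (level (Suc m))"
    then obtain u where u: "u \<in> fun_space (level m)" "lower (v - raise u) = 0"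
      by (rule level_split)
    have "v - raise u \<in> primitive (Suc m)"
      using u(2) fun_vs.subspace_diff[OF subspace_fun_space v raise_level[OF u(1)]]
      by (simp add: primitive_def)
    then have "v - raise u \<in> fun_vs.span (prim_basis (Suc m))"
      using prim_basis(3) by blast
    moreover have "prim_basis (Suc m) \<subseteq> ?S (Suc m)"
      by (force simp: string_vec_def)
    ultimately have 1: "v - raise u \<in> fun_vs.span (?S (Suc m))"
      using fun_vs.span_mono by blast
    have "raise u \<in> raise ` fun_vs.span (?S m)" using Suc.IH u(1) by blast
    then have "raise u \<in> fun_vs.span (raise ` ?S m)"
      by (simp only: fun_vs_pair.linear_span_image[OF linear_raise])
    moreover have "raise ` ?S m \<subseteq> ?S (Suc m)"
    proof
      fix f assume "f \<in> raise ` ?S m"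
      then obtain j b where jb: "j \<le> m" "b \<in> prim_basis j" "f = raise ((raise ^^ (m - j)) b)"
        by (auto simp: string_vec_def)
      then have "f = string_vec (Suc m) (j, b)" by (simp add: string_vec_def Suc_diff_le)
      then show "f \<in> ?S (Suc m)" using jb by (intro image_eqI) auto
    qed
    ultimately have 2: "raise u \<in> fun_vs.span (?S (Suc m))"
      using fun_vs.span_mono by blast
    from fun_vs.span_add[OF 1 2] show "v \<in> fun_vs.span (?S (Suc m))" by simp
  qed
qed

lemma string_vec_basis:
  "inj_on (string_vec m) (strings m)"
  "fun_vs.independent (string_vec m ` strings m)"
  "fun_vs.span (string_vec m ` strings m) = fun_space (level m)"
proof -
  show "inj_on (string_vec m) (strings m)" "fun_vs.independent (string_vec m ` strings m)"
    using independent_familyI[where \<Phi> = "string_vec m", OF finite_strings] string_vec_coeffs_zero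
    by blast+
  show "fun_vs.span (string_vec m ` strings m) = fun_space (level m)"
  proof
    show "fun_vs.span (string_vec m ` strings m) \<subseteq> fun_space (level m)"
    proof (rule fun_vs.span_minimal[OF _ subspace_fun_space], clarify)
      fix j b assume "(j, b) \<in> strings m"
      then have "j \<le> m" "b \<in> prim_basis j" by (auto simp: strings_def)
      then show "string_vec m (j, b) \<in> fun_space (level m)"
        using raise_pow_level[of b j "m - j"] prim_basisD(1) by (simp add: string_vec_def)
    qed
    have "string_vec m ` (SIGMA j:{..m}. prim_basis j) \<subseteq> fun_vs.span (string_vec m ` strings m)"
    proof clarify
      fix j b assume jb: "j \<le> m" "b \<in> prim_basis j"
      show "string_vec m (j, b) \<in> fun_vs.span (string_vec m ` strings m)"
      proof (cases "m + j \<le> rk")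
        case True
        then show ?thesis using jb by (intro fun_vs.span_base imageI) (auto simp: strings_def)
      next
        case False
        then have "string_vec m (j, b) = 0"
          using prim_basis_top[OF jb(2)] jb(1) by (simp add: string_vec_def)
        then show ?thesis by (simp add: fun_vs.span_zero)
      qed
    qed
    then show "fun_space (level m) \<subseteq> fun_vs.span (string_vec m ` strings m)"
      using level_subset_span_strings fun_vs.span_minimal[OF _ fun_vs.subspace_span] by blast
  qed
qed

lemma card_level: "card (level m) = (\<Sum>j | j \<le> m \<and> m + j \<le> rk. card (prim_basis j))"
proof -
  have "card (level m) = card (strings m)"
    using card_basis_fun_space[OF finite_level string_vec_basis(2,3)] card_image[OF string_vec_basis(1)]
    by metis
  also have "\<dots> = (\<Sum>j | j \<le> m \<and> m + j \<le> rk. card (prim_basis j))"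
    unfolding strings_def
    by (intro card_SigmaI) (auto intro: finite_subset[of _ "{..m}"] simp: finite_prim_basis)
  finally show ?thesis .
qed

section \<open>Primitive vectors as polynomials\<close>

definition point :: "('n \<Rightarrow> nat) \<Rightarrow> real ^ 'n" where
  "point a = (\<chi> i. real (a i))"

abbreviation binom :: "('n \<Rightarrow> nat) \<Rightarrow> real ^ 'n \<Rightarrow> real" where
  "binom \<equiv> tensor (\<lambda>n x. x gchoose n)"

text \<open>In one chain, \<open>raise\<close> applied s times to the delta function at a has the
  value (a + s)! / a! = s! C(a + s, a) at a + s. Products of binomials thus interpolate the powers
  of \<open>raise\<close>, and \<open>hat\<close> extends this linearly.\<close>

definition hat :: "(('n \<Rightarrow> nat) \<Rightarrow> real) \<Rightarrow> real ^ 'n \<Rightarrow> real" where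
  "hat v x = (\<Sum>a\<in>pts. v a * binom a x)"

lemma hat_in_polyfn:
  assumes "v \<in> fun_space (level j)"
  shows "hat v \<in> polyfn j"
proof -
  have "hat v = (\<Sum>a\<in>level j. fun_scale (v a) (binom a))"
    unfolding fun_eq_iff sum_fun_apply hat_def using assms
    by (auto intro!: sum.mono_neutral_right simp: finite_pts level_def fun_space_def)
  also have "\<dots> \<in> polyfn j"
    unfolding polyfn_eq_span_gbinomial
    by (intro fun_vs.span_sum fun_vs.span_scale fun_vs.span_base) (auto simp: tensors_def level_def)
  finally show ?thesis .
qed

lemma binom_point: "binom a (point x) = (\<Prod>i\<in>UNIV. real (x i choose a i))"
  by (simp add: tensor_def point_def binomial_gbinomial)

lemma binom_point_eq_0:
  assumes "sum x UNIV < sum a UNIV \<or> sum x UNIV = sum a UNIV \<and> x \<noteq> a"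
  shows "binom a (point x) = 0"
proof -
  have "\<exists>i. x i < a i"
  proof (rule ccontr)
    assume "\<nexists>i. x i < a i"
    then have le: "\<And>i. a i \<le> x i" by (auto simp: not_less)
    then have "sum a UNIV \<le> sum x UNIV" by (intro sum_mono) auto
    then have eq: "sum x UNIV = sum a UNIV" "x \<noteq> a" using assms by auto
    then obtain i where "a i < x i" using le by (metis ext le_neq_implies_less)
    then have "sum a UNIV < sum x UNIV" using le by (intro sum_strict_mono_ex1) auto
    then show False using eq by simp
  qed
  then show ?thesis by (auto simp: binom_point)
qed

text \<open>Absorption x C(x - 1, a) = (x - a) C(x, a) in coordinate i, valid at
  \<open>x i = 0\<close> as well since both sides are then 0.\<close>

lemma binom_point_step: "real (x i) * binom a (point (x(i := x i - 1))) = (real (x i) - real (a i)) * binom a (point x)"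
proof -
  have r: "binom a (point y) = real (y i choose a i) * (\<Prod>l\<in>UNIV - {i}. real (y l choose a l))" for y
    unfolding binom_point by (simp add: prod.remove)
  have "(\<Prod>l\<in>UNIV - {i}. real ((x(i := x i - 1)) l choose a l)) = (\<Prod>l\<in>UNIV - {i}. real (x l choose a l))"
    by (intro prod.cong) auto
  moreover have "real (x i) * real (x i - 1 choose a i) = (real (x i) - real (a i)) * real (x i choose a i)"
  proof (cases "x i < a i")
    case True
    then have "x i - 1 < a i" by linarith
    then show ?thesis using True by (simp only: binomial_eq_0)
  next
    case False
    then show ?thesis
      using binomial_absorb_comp[of "x i" "a i"] by (metis not_less of_nat_diff of_nat_mult)
  qed
  ultimately show ?thesis unfolding r[of x] r[of "x(i := x i - 1)"] by simp
qed

lemma hat_eq_0: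
  assumes "v \<in> fun_space (level j)" "sum x UNIV < j"
  shows "hat v (point x) = 0"
proof -
  have "v a * binom a (point x) = 0" for a
    using assms binom_point_eq_0[of x a] by (cases "a \<in> level j") (auto simp: level_def fun_space_def)
  then show ?thesis unfolding hat_def by (simp only: sum.neutral_const)
qed

text \<open>One more \<open>raise\<close> sums \<open>binom_point_step\<close> over all coordinates,
  giving the factor sum x - sum a = s + 1 for every \<open>a\<close> of level \<open>j\<close>;
  these factors build up the factorial.\<close>

lemma raise_pow_eq_hat:
  assumes v: "v \<in> fun_space (level j)"
  shows "x \<in> level (j + s) \<Longrightarrow> (raise ^^ s) v x = fact s * hat v (point x)"
proof (induction s arbitrary: x)
  case 0
  have "v a * binom a (point x) = (if a = x then v a else 0)" for a
  proof (cases "a \<in> level j")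
    case True
    then have "binom a (point x) = 0" if "a \<noteq> x"
      using 0 that binom_point_eq_0[of x a] by (auto simp: level_def)
    moreover have "binom x (point x) = 1" by (simp add: binom_point)
    ultimately show ?thesis by auto
  qed (use v in \<open>auto simp: fun_space_def\<close>)
  then have "hat v (point x) = v x"
    unfolding hat_def using 0 by (simp add: finite_pts level_def)
  then show ?case by simp
next
  case (Suc s)
  have x: "x \<in> pts" "sum x UNIV = j + Suc s" using Suc.prems by (auto simp: level_def)
  have t: "real (x i) * (raise ^^ s) v (x(i := x i - 1)) = fact s * (real (x i) * hat v (point (x(i := x i - 1))))" for i
  proof (cases "x i = 0")
    case False
    have "x(i := x i - 1) \<in> pts" using x(1) unfolding pts_def by (auto intro: order.trans[OF diff_le_self])
    then have "x(i := x i - 1) \<in> level (j + s)"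
      using False x sum_fun_upd[of x i "x i - 1"] by (simp add: level_def del: fun_upd_apply)
    from Suc.IH[OF this] show ?thesis by (simp only: mult_ac)
  qed simp
  have a: "(\<Sum>i\<in>UNIV. v a * (real (x i) * binom a (point (x(i := x i - 1))))) = real (Suc s) * (v a * binom a (point x))" for a
  proof (cases "a \<in> level j")
    case True
    have "(\<Sum>i\<in>UNIV. v a * (real (x i) * binom a (point (x(i := x i - 1)))))
      = v a * ((\<Sum>i\<in>UNIV. real (x i) - real (a i)) * binom a (point x))"
      unfolding binom_point_step by (simp only: sum_distrib_left sum_distrib_right)
    also have "(\<Sum>i\<in>UNIV. real (x i) - real (a i)) = real (Suc s)"
      using x(2) True by (simp add: sum_subtractf level_def flip: of_nat_sum)
    finally show ?thesis by (simp only: mult_ac)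
  qed (use v in \<open>simp add: fun_space_def\<close>)
  have "(raise ^^ Suc s) v x = (\<Sum>i\<in>UNIV. real (x i) * (raise ^^ s) v (x(i := x i - 1)))"
    using x(1) by (simp add: raise_def)
  also have "\<dots> = fact s * (\<Sum>i\<in>UNIV. real (x i) * hat v (point (x(i := x i - 1))))"
    by (simp only: t sum_distrib_left)
  also have "(\<Sum>i\<in>UNIV. real (x i) * hat v (point (x(i := x i - 1))))
      = (\<Sum>a\<in>pts. \<Sum>i\<in>UNIV. v a * (real (x i) * binom a (point (x(i := x i - 1)))))"
    unfolding hat_def by (subst sum.swap) (simp add: sum_distrib_left mult_ac)
  also have "\<dots> = real (Suc s) * hat v (point x)"
    by (simp only: a hat_def sum_distrib_left)
  finally show ?case by (simp add: mult_ac)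
qed

text \<open>Below level j every binomial involved vanishes; above level rk - j the value is, up to a
  factorial, that of a string that has ended.\<close>

lemma hat_prim_basis_eq_0:
  assumes "b \<in> prim_basis j" "x \<in> level m" "\<not> (j \<le> m \<and> m + j \<le> rk)"
  shows "hat b (point x) = 0"
proof (cases "m < j")
  case True
  then show ?thesis using hat_eq_0[OF prim_basisD(1)[OF assms(1)]] assms(2) by (simp add: level_def)
next
  case False
  then have "(raise ^^ (m - j)) b x = fact (m - j) * hat b (point x)"
    using assms(2) by (intro raise_pow_eq_hat[OF prim_basisD(1)[OF assms(1)]]) auto
  moreover have "(raise ^^ (m - j)) b = 0"
    using False assms(3) by (intro prim_basis_top[OF assms(1)]) auto
  ultimately show ?thesis by simp
qed

text \<open>Makes the ratio of (w - j)! and (w - m)! a polynomial in w of degree m - j, which can be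
  evaluated at \<open>wt\<close>.\<close>

lemma prod_diff_fact:
  assumes "j \<le> m" "m \<le> w"
  shows "(\<Prod>i\<in>{j..<m}. real w - real i) * fact (w - m) = fact (w - j)"
  using assms
proof (induction m rule: dec_induct)
  case (step m)
  have "fact (w - m) = (real w - real m) * fact (w - Suc m)"
    using step.prems by (simp add: fact_reduce of_nat_diff)
  then show ?case using step by (simp add: prod.atLeastLessThan_Suc mult_ac)
qed simp

text \<open>Expand the delta function at \<open>a\<close> in the string basis of level m and apply
  \<open>raise\<close> w - m times: each string vector becomes \<open>raise ^^ (w - j)\<close> of
  its primitive vector, and the factorials combine into the product. On layers w < m the left side
  is 0, and so is each term: for w < j through \<open>hat b\<close>, otherwise through the factor i
  = w.\<close>

lemma binom_expansion:
  assumes a: "a \<in> level m"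
  obtains c where "\<And>x. x \<in> pts \<Longrightarrow> binom a (point x)
    = (\<Sum>(j, b)\<in>strings m. c (j, b) * (\<Prod>i\<in>{j..<m}. real (sum x UNIV) - real i) * hat b (point x))"
proof -
  let ?v = "indicator {a} :: ('n \<Rightarrow> nat) \<Rightarrow> real"
  have v: "?v \<in> fun_space (level m)" using a by (auto simp: fun_space_def indicator_def)
  then have "?v \<in> fun_vs.span (string_vec m ` strings m)" using string_vec_basis(3) by simp
  then obtain c where c: "\<And>x. ?v x = (\<Sum>p\<in>strings m. c p * string_vec m p x)"
    using span_image_coeffs[OF finite_strings] by blast
  have hv: "hat ?v y = binom a y" for y
  proof -
    have "hat ?v y = (\<Sum>a'\<in>pts. if a' = a then binom a y else 0)"
      unfolding hat_def by (intro sum.cong) auto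
    then show ?thesis using a finite_pts by (simp add: level_def)
  qed
  show thesis
  proof (rule that[of c])
    fix x assume x: "x \<in> pts"
    define w where "w = sum x UNIV"
    have xw: "x \<in> level w" using x by (simp add: level_def w_def)
    show "binom a (point x)
      = (\<Sum>(j, b)\<in>strings m. c (j, b) * (\<Prod>i\<in>{j..<m}. real (sum x UNIV) - real i) * hat b (point x))"
    proof (cases "w < m")
      case True
      have "c (j, b) * (\<Prod>i\<in>{j..<m}. real w - real i) * hat b (point x) = 0"
        if "(j, b) \<in> strings m" for j b
      proof (cases "w < j")
        case True
        then show ?thesis using hat_prim_basis_eq_0[of b j x w] xw that by (auto simp: strings_def)
      next
        case False
        then have "(\<Prod>i\<in>{j..<m}. real w - real i) = 0"
          using True by (intro prod_zero bexI[of _ w]) auto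
        then show ?thesis by simp
      qed
      then have "(\<Sum>(j, b)\<in>strings m. c (j, b) * (\<Prod>i\<in>{j..<m}. real w - real i) * hat b (point x)) = 0"
        by (intro sum.neutral) auto
      then show ?thesis using True binom_point_eq_0[of x a] a by (simp add: w_def level_def)
    next
      case False
      define s where "s = w - m"
      have ws: "w = m + s" using False by (simp add: s_def)
      have "?v = (\<Sum>p\<in>strings m. fun_scale (c p) (string_vec m p))"
        using c by (simp add: fun_eq_iff sum_fun_apply)
      then have "(raise ^^ s) ?v x = (\<Sum>p\<in>strings m. c p * (raise ^^ s) (string_vec m p) x)"
        by (simp add: fun_vs_pair.linear_sum[OF linear_raise_pow] fun_vs_pair.linear_scale[OF linear_raise_pow]
            sum_fun_apply)
      also have "\<dots> = (\<Sum>(j, b)\<in>strings m. fact s * (c (j, b) * (\<Prod>i\<in>{j..<m}. real w - real i) * hat b (point x)))"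
      proof (rule sum.cong[OF refl], clarify)
        fix j b assume "(j, b) \<in> strings m"
        then have jb: "j \<le> m" "b \<in> prim_basis j" by (auto simp: strings_def)
        have "(raise ^^ s) (string_vec m (j, b)) x = (raise ^^ (s + (m - j))) b x"
          by (simp add: string_vec_def funpow_add)
        also have "s + (m - j) = w - j" using jb ws by simp
        also have "(raise ^^ (w - j)) b x = fact (w - j) * hat b (point x)"
          using jb xw ws by (intro raise_pow_eq_hat[OF prim_basisD(1)[OF jb(2)]]) auto
        also have "fact (w - j) = (\<Prod>i\<in>{j..<m}. real w - real i) * fact s"
          using prod_diff_fact[of j m w] jb(1) ws by simp
        finally show "c (j, b) * (raise ^^ s) (string_vec m (j, b)) x
          = fact s * (c (j, b) * (\<Prod>i\<in>{j..<m}. real w - real i) * hat b (point x))"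
          by (simp add: mult_ac)
      qed
      also have "\<dots> = fact s * (\<Sum>(j, b)\<in>strings m. c (j, b) * (\<Prod>i\<in>{j..<m}. real w - real i) * hat b (point x))"
        by (simp add: sum_distrib_left case_prod_unfold)
      finally have "fact s * binom a (point x)
        = fact s * (\<Sum>(j, b)\<in>strings m. c (j, b) * (\<Prod>i\<in>{j..<m}. real w - real i) * hat b (point x))"
        using raise_pow_eq_hat[OF v, of x s] xw ws hv by simp
      then show ?thesis by (simp add: w_def)
    qed
  qed
qed

section \<open>The Hilbert function of a union of layers\<close>

definition shell :: "nat set \<Rightarrow> (real ^ 'n) set" where
  "shell E = point ` {x \<in> pts. sum x UNIV \<in> E}"

text \<open>The only layers of \<open>E\<close> on which \<open>hat b\<close>, for \<open>b\<close>
  in \<open>prim_basis j\<close>, can be nonzero.\<close>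

definition window :: "nat set \<Rightarrow> nat \<Rightarrow> nat set" where
  "window E j = {v \<in> E. j \<le> v \<and> v + j \<le> rk}"

lemma wt_point: "wt (point x) = real (sum x UNIV)"
  by (simp add: wt_def point_def)

lemma finite_window: "finite (window E j)"
  by (rule finite_subset[of _ "{..rk}"]) (auto simp: window_def)

lemma hat_shell_eq_0:
  assumes "b \<in> prim_basis j" "x \<in> pts" "sum x UNIV \<in> E - window E j"
  shows "hat b (point x) = 0"
  using hat_prim_basis_eq_0[OF assms(1), of x "sum x UNIV"] assms(2,3)
  by (auto simp: level_def window_def)

text \<open>Each \<open>b\<close> in \<open>prim_basis j\<close> contributes the polynomials in
  \<open>wt\<close> of degree at most d - j restricted to \<open>window E j\<close>, a space whose
  dimension is the minimum; contributions of different \<open>b\<close> are independent.\<close>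

lemma hilbert_fn_shell:
  "hilbert_fn d (shell E) = (\<Sum>j\<le>d. card (prim_basis j) * min (Suc d - j) (card (window E j)))"
proof -
  have "\<forall>j. \<exists>X\<subseteq>window E j. card X = min (Suc d - j) (card (window E j))"
    by (meson min.cobounded2 obtain_subset_with_card_n)
  then obtain X where X: "\<And>j. X j \<subseteq> window E j" "\<And>j. card (X j) = min (Suc d - j) (card (window E j))"
    by metis
  have finX: "finite (X j)" for j using X(1) finite_window finite_subset by blast
  \<comment> \<open>The nodes \<open>X j\<close> either number more than the degree \<open>d - j\<close> available next to \<open>hat b\<close>, or exhaust
    the layers of \<open>E\<close> on which \<open>hat b\<close> can be nonzero, so \<open>cut (lagrange (X j) w) b\<close> form a basis.\<close>
  define S where "S = (SIGMA j:{..d}. prim_basis j)"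
  define T where "T = (SIGMA p:S. X (fst p))"
  have finS: "finite S" unfolding S_def by (intro finite_SigmaI finite_prim_basis) simp
  then have finT: "finite T" unfolding T_def by (intro finite_SigmaI finX)
  \<comment> \<open>The indicator selects the representative that vanishes outside the set, as
    \<open>fun_space\<close> requires.\<close>
  define cut where "cut = (\<lambda>q b y. indicator (shell E) y * (poly q (wt y) * hat b y) :: real)"
  define \<Phi> where "\<Phi> = (\<lambda>((j, b), w). cut (lagrange (X j) w) b)"
  have cut_point: "cut q b (point x) = poly q (real (sum x UNIV)) * hat b (point x)"
    if "x \<in> pts" "sum x UNIV \<in> E" for q b x
    using that by (auto simp: cut_def shell_def wt_point)

  have mem: "\<Phi> p \<in> fun_space_deg d (shell E)" if "p \<in> T" for p
  proof -
    from that obtain j b w where p: "p = ((j, b), w)" "j \<le> d" "b \<in> prim_basis j" "w \<in> X j"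
      by (auto simp: T_def S_def)
    have "degree (lagrange (X j) w) \<le> d - j"
      using degree_lagrange[OF p(4)] X(2)[of j] by linarith
    from poly_wt_mult_polyfn[OF hat_in_polyfn[OF prim_basisD(1)[OF p(3)]] this]
    have "(\<lambda>y. poly (lagrange (X j) w) (wt y) * hat b y) \<in> polyfn d" using p(2) by simp
    then obtain q where q: "degree_at_most q d" "(\<lambda>y. poly (lagrange (X j) w) (wt y) * hat b y) = eval_rpoly q"
      by (rule polyfn_imp_rpoly)
    have "\<Phi> p y = eval_rpoly q y" if "y \<in> shell E" for y
      using that fun_cong[OF q(2), of y] by (simp add: \<Phi>_def cut_def p)
    moreover have "\<Phi> p \<in> fun_space (shell E)" by (simp add: \<Phi>_def cut_def p fun_space_def)
    ultimately show ?thesis using q(1) by (auto simp: fun_space_deg_def)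
  qed

  have zero: "c p = 0" if c: "\<And>y. (\<Sum>p\<in>T. c p * \<Phi> p y) = 0" and p: "p \<in> T" for c p
  proof -
    obtain j0 b0 v where p0: "p = ((j0, b0), v)" "j0 \<le> d" "b0 \<in> prim_basis j0" "v \<in> X j0"
      using p by (auto simp: T_def S_def)
    have v: "v \<in> window E j0" using p0(4) X(1) by blast
    define e where "e = (\<lambda>(j, b). \<Sum>w\<in>X j. c ((j, b), w) * poly (lagrange (X j) w) (real v))"
    \<comment> \<open>On layer v the relation reads as the sum of \<open>e p\<close> times
      \<open>hat\<close>; dividing by the factorial passes from \<open>hat\<close> to
      \<open>string_vec\<close>. Strings starting above level d do not occur in \<open>T\<close> and
      get coefficient 0, while members of \<open>S\<close> missing layer v have \<open>hat\<close>
      equal to 0 there.\<close>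
    let ?g = "\<lambda>p. if fst p \<le> d then e p / fact (v - fst p) else 0"
    have "(\<Sum>p\<in>strings v. ?g p * string_vec v p x) = 0" for x
    proof (cases "x \<in> level v")
      case False
      have "string_vec v p x = 0" if "p \<in> strings v" for p
        using False string_vec_basis(3)[of v] fun_vs.span_base[OF imageI[OF that, of "string_vec v"]]
        by (auto simp: fun_space_def)
      then show ?thesis by simp
    next
      case True
      then have x: "x \<in> pts" "sum x UNIV = v" "v \<in> E" using v by (auto simp: level_def window_def)
      have "(\<Sum>p\<in>strings v. ?g p * string_vec v p x)
        = (\<Sum>p\<in>strings v. if fst p \<le> d then e p * hat (snd p) (point x) else 0)"
      proof (rule sum.cong[OF refl], clarify)
        fix j b assume "(j, b) \<in> strings v"
        then have jb: "j \<le> v" "b \<in> prim_basis j" by (auto simp: strings_def)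
        then have "string_vec v (j, b) x = fact (v - j) * hat b (point x)"
          unfolding string_vec_def prod.case using True
          by (intro raise_pow_eq_hat[OF prim_basisD(1)[OF jb(2)]]) simp
        then show "?g (j, b) * string_vec v (j, b) x
          = (if fst (j, b) \<le> d then e (j, b) * hat (snd (j, b)) (point x) else 0)" by simp
      qed
      also have "\<dots> = (\<Sum>p\<in>strings v \<inter> {p. fst p \<le> d}. e p * hat (snd p) (point x))"
        by (simp add: sum.inter_restrict[OF finite_strings])
      also have "\<dots> = (\<Sum>p\<in>S. e p * hat (snd p) (point x))"
      proof (rule sum.mono_neutral_left[OF finS])
        show "strings v \<inter> {p. fst p \<le> d} \<subseteq> S" by (auto simp: strings_def S_def)
        have "hat (snd p) (point x) = 0" if "p \<in> S" "p \<notin> strings v \<inter> {p. fst p \<le> d}" for p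
          using that by (intro hat_prim_basis_eq_0[OF _ True, of _ "fst p"]) (auto simp: S_def strings_def)
        then show "\<forall>p\<in>S - strings v \<inter> {p. fst p \<le> d}. e p * hat (snd p) (point x) = 0"
          by simp
      qed
      also have "\<dots> = (\<Sum>p\<in>S. \<Sum>w\<in>X (fst p). c (p, w) * \<Phi> (p, w) (point x))"
        using x by (intro sum.cong[OF refl])
          (auto simp: e_def \<Phi>_def cut_point sum_distrib_right mult.assoc)
      also have "\<dots> = (\<Sum>p\<in>T. c p * \<Phi> p (point x))"
        unfolding T_def using finS finX by (subst sum.Sigma) auto
      finally show ?thesis using c by simp
    qed
    moreover have "(j0, b0) \<in> strings v" using p0 v by (auto simp: strings_def window_def)
    ultimately have "?g (j0, b0) = 0" by (rule string_vec_coeffs_zero)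
    then have "e (j0, b0) = 0" using p0(2) by simp
    moreover have "e (j0, b0) = (\<Sum>w\<in>X j0. if v = w then c ((j0, b0), w) else 0)"
      unfolding e_def prod.case poly_lagrange[OF finX p0(4)] by (intro sum.cong) auto
    ultimately show ?thesis using p0 finX by simp
  qed

  have cut_span: "cut q b \<in> fun_vs.span (\<Phi> ` T)"
    if jb: "j \<le> d" "b \<in> prim_basis j" "degree q \<le> d - j" for q b j
  proof -
    have "cut q b = (\<Sum>w\<in>X j. fun_scale (poly q (real w)) (\<Phi> ((j, b), w)))"
    proof
      fix y
      show "cut q b y = (\<Sum>w\<in>X j. fun_scale (poly q (real w)) (\<Phi> ((j, b), w))) y"
      proof (cases "y \<in> shell E")
        case False
        then show ?thesis by (simp add: cut_def \<Phi>_def sum_fun_apply)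
      next
        case True
        then obtain x where x: "y = point x" "x \<in> pts" "sum x UNIV \<in> E" by (auto simp: shell_def)
        let ?v = "sum x UNIV"
        have r: "(\<Sum>w\<in>X j. fun_scale (poly q (real w)) (\<Phi> ((j, b), w))) y
          = (\<Sum>w\<in>X j. poly q (real w) * poly (lagrange (X j) w) (real ?v)) * hat b y"
          unfolding x(1) using x(2,3) by (simp add: sum_fun_apply \<Phi>_def cut_point sum_distrib_right mult.assoc)
        show ?thesis
        proof (cases "?v \<in> window E j")
          case False
          then have "hat b y = 0" using hat_shell_eq_0[OF jb(2) x(2)] x(1,3) by blast
          then show ?thesis unfolding r by (simp add: cut_def)
        next
          case v: True
          have "poly q (real ?v) = (\<Sum>w\<in>X j. poly q (real w) * poly (lagrange (X j) w) (real ?v))"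
          proof (cases "degree q < card (X j)")
            case True
            then show ?thesis by (rule lagrange_interpolation[OF finX])
          next
            case False
            then have "card (X j) = card (window E j)" using X(2)[of j] jb by linarith
            then have "?v \<in> X j" using v card_subset_eq[OF finite_window X(1)] by blast
            then show ?thesis
              by (simp only: poly_lagrange[OF finX]) (simp add: finX if_distrib[of "\<lambda>z. _ * z"] cong: if_cong)
          qed
          then show ?thesis unfolding r using x by (simp add: cut_point)
        qed
      qed
    qed
    also have "\<dots> \<in> fun_vs.span (\<Phi> ` T)"
      using jb by (intro fun_vs.span_sum fun_vs.span_scale fun_vs.span_base imageI) (auto simp: T_def S_def)
    finally show ?thesis .
  qed

  have span: "fun_space_deg d (shell E) \<subseteq> fun_vs.span (\<Phi> ` T)"
  proof
    fix f assume "f \<in> fun_space_deg d (shell E)"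
    then obtain p where f: "f \<in> fun_space (shell E)" and p: "degree_at_most p d"
      "\<And>y. y \<in> shell E \<Longrightarrow> f y = eval_rpoly p y" by (auto simp: fun_space_deg_def)
    have feq: "f = (\<lambda>y. indicator (shell E) y * eval_rpoly p y)"
      using f p(2) by (auto simp: fun_eq_iff fun_space_def indicator_def)
    show "f \<in> fun_vs.span (\<Phi> ` T)" unfolding feq
    proof (rule mult_mem_span)
      show "eval_rpoly p \<in> fun_vs.span (tensors (\<lambda>n x. x gchoose n) d)"
        using eval_rpoly_in_polyfn[OF p(1)] by (simp only: polyfn_eq_span_gbinomial)
    next
      fix g :: "real ^ 'n \<Rightarrow> real" assume "g \<in> tensors (\<lambda>n x. x gchoose n) d"
      then obtain a where a: "g = binom a" "sum a UNIV \<le> d" by (auto simp: tensors_def)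
      define m where "m = sum a UNIV"
      show "(\<lambda>y. indicator (shell E) y * g y) \<in> fun_vs.span (\<Phi> ` T)"
      proof (cases "a \<in> pts")
        \<comment> \<open>Exponents beyond the box give binomials that vanish on the whole
          grid.\<close>
        case False
        then obtain i where i: "K i < a i" by (auto simp: pts_def not_le)
        have "binom a (point x) = 0" if "x \<in> pts" for x
        proof -
          have "x i < a i" using that i by (auto simp: pts_def intro: le_less_trans)
          then show ?thesis unfolding binom_point by (auto intro!: bexI[of _ i])
        qed
        then have "(\<lambda>y. indicator (shell E) y * g y) = 0"
          by (auto simp: fun_eq_iff a shell_def indicator_def)
        then show ?thesis by (simp only: fun_vs.span_zero)
      next
        case True
        then have "a \<in> level m" by (simp add: level_def m_def)
        then obtain c where c: "\<And>x. x \<in> pts \<Longrightarrow> binom a (point x)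
          = (\<Sum>(j, b)\<in>strings m. c (j, b) * (\<Prod>i\<in>{j..<m}. real (sum x UNIV) - real i) * hat b (point x))"
          by (rule binom_expansion) blast
        \<comment> \<open>The falling product of \<open>binom_expansion\<close> as a polynomial in
          the weight; its degree m - j leaves room for \<open>cut_span\<close> since m \<le>
          d.\<close>
        define q where "q = (\<lambda>j. \<Prod>i\<in>{j..<m}. [:- real i, 1:])"
        have dq: "degree (q j) \<le> m - j" for j
          using degree_prod_sum_le[of "{j..<m}" "\<lambda>i. [:- real i, 1:]"] by (simp add: q_def o_def)
        have "(\<lambda>y. indicator (shell E) y * g y) = (\<Sum>p\<in>strings m. fun_scale (c p) (cut (q (fst p)) (snd p)))"
        proof
          fix y
          show "indicator (shell E) y * g y = (\<Sum>p\<in>strings m. fun_scale (c p) (cut (q (fst p)) (snd p))) y"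
          proof (cases "y \<in> shell E")
            case False
            then show ?thesis by (simp add: cut_def sum_fun_apply)
          next
            case True
            then obtain x where x: "y = point x" "x \<in> pts" "sum x UNIV \<in> E" by (auto simp: shell_def)
            have "(\<Sum>p\<in>strings m. fun_scale (c p) (cut (q (fst p)) (snd p))) y = binom a y"
              unfolding x(1) c[OF x(2)] sum_fun_apply fun_scale_apply cut_point[OF x(2,3)]
              by (intro sum.cong) (auto simp: q_def poly_prod mult.assoc)
            then show ?thesis using True by (simp add: a)
          qed
        qed
        also have "\<dots> \<in> fun_vs.span (\<Phi> ` T)"
        proof (intro fun_vs.span_sum fun_vs.span_scale)
          fix p assume "p \<in> strings m"
          then have "fst p \<le> m" "snd p \<in> prim_basis (fst p)" by (auto simp: strings_def)
          moreover have "m \<le> d" using a(2) by (simp add: m_def)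
          ultimately show "cut (q (fst p)) (snd p) \<in> fun_vs.span (\<Phi> ` T)"
            using dq[of "fst p"] by (intro cut_span[of "fst p"]) auto
        qed
        finally show ?thesis .
      qed
    qed
  qed

  have "hilbert_fn d (shell E) = card (\<Phi> ` T)"
    unfolding hilbert_fn_def
    by (rule fun_vs.dim_unique[OF _ span independent_familyI(2)[where \<Phi> = \<Phi>, OF finT] refl])
      (use mem zero in blast)+
  also have "\<dots> = card T"
    by (rule card_image, rule independent_familyI(1)[OF finT]) (use zero in blast)
  also have "\<dots> = (\<Sum>p\<in>S. card (X (fst p)))"
    unfolding T_def using finS finX by simp
  also have "\<dots> = (\<Sum>j\<le>d. \<Sum>b\<in>prim_basis j. card (X j))"
    unfolding S_def using finite_prim_basis by (subst sum.Sigma) (auto simp: case_prod_unfold)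
  also have "\<dots> = (\<Sum>j\<le>d. card (prim_basis j) * min (Suc d - j) (card (window E j)))"
    by (simp add: X(2))
  finally show ?thesis .
qed

section \<open>Counting for each starting level of strings\<close>

lemma level_card_segment:
  "v \<le> rk \<Longrightarrow> card (level v) = (\<Sum>j\<le>min v (rk - v). card (prim_basis j))"
  unfolding card_level by (intro sum.cong) auto

text \<open>Level sizes are partial sums of one sequence of naturals, so the smaller of two is the
  partial sum over the j whose strings meet both levels.\<close>

lemma min_card_level:
  assumes "u \<le> rk" "v \<le> rk"
  shows "min (card (level u)) (card (level v))
    = (\<Sum>j\<le>rk. card (prim_basis j) * (if j \<le> u \<and> u + j \<le> rk \<and> j \<le> v \<and> v + j \<le> rk then 1 else 0))"
proof -
  have mono: "(\<Sum>j\<le>a. card (prim_basis j)) \<le> (\<Sum>j\<le>b. card (prim_basis j))" if "a \<le> b" for a b :: nat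
    using that by (intro sum_mono2) auto
  have "min (card (level u)) (card (level v))
      = (\<Sum>j\<le>min (min u (rk - u)) (min v (rk - v)). card (prim_basis j))"
    unfolding level_card_segment[OF assms(1)] level_card_segment[OF assms(2)]
    using mono[of "min u (rk - u)" "min v (rk - v)"] mono[of "min v (rk - v)" "min u (rk - u)"]
    by (auto simp: min_def)
  also have "\<dots> = (\<Sum>j\<in>{j \<in> {..rk}. j \<le> u \<and> u + j \<le> rk \<and> j \<le> v \<and> v + j \<le> rk}. card (prim_basis j))"
    using assms by (intro sum.cong) auto
  also have "\<dots> = (\<Sum>j\<le>rk. card (prim_basis j) * (if j \<le> u \<and> u + j \<le> rk \<and> j \<le> v \<and> v + j \<le> rk then 1 else 0))"
    by (subst sum.inter_filter) (auto intro!: sum.cong)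
  finally show ?thesis .
qed

text \<open>When j \<le> d \<le> rk - j, remove \<open>E \<inter> {j..d}\<close> from both [j, d]
  and \<open>window E j\<close>. What remains are the t_i \<ge> j and the w_i \<le> rk - j, two
  initial segments of indices, and the minimum of their lengths counts the common indices.\<close>

lemma card_window_split:
  fixes l r :: nat
  assumes d: "d \<le> rk" and E: "E \<subseteq> {0..rk}"
    and t: "strict_antimono_on {1..l} t" "t ` {1..l} = {0..d} - E"
    and w: "strict_mono_on {1..r} w" "w ` {1..r} = E - {0..d}"
  shows "min (Suc d - j) (card (window E j))
    = card {v \<in> E \<inter> {0..d}. j \<le> v \<and> v + j \<le> rk}
      + card {i \<in> {1..min l r}. j \<le> t i \<and> t i + j \<le> rk \<and> j \<le> w i \<and> w i + j \<le> rk}"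
proof -
  have t_le: "t i \<le> d" "t i \<notin> E" if "i \<in> {1..l}" for i
    using imageI[OF that, of t] unfolding t(2) by auto
  have w_gt: "d < w i" "w i \<in> E" if "i \<in> {1..r}" for i
    using imageI[OF that, of w] unfolding w(2) by auto
  have finE: "finite E" using E finite_subset by blast
  show ?thesis
  proof (cases "j \<le> d")
    case False
    have 1: "{v \<in> E \<inter> {0..d}. j \<le> v \<and> v + j \<le> rk} = {}" using False by auto
    have 2: "{i \<in> {1..min l r}. j \<le> t i \<and> t i + j \<le> rk \<and> j \<le> w i \<and> w i + j \<le> rk} = {}"
    proof -
      have "\<not> j \<le> t i" if "i \<in> {1..min l r}" for i
        using t_le(1)[of i] False that by (auto simp: min.bounded_iff)
      then show ?thesis by blast
    qed
    show ?thesis unfolding 1 2 using False by simp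
  next
    case jd: True
    show ?thesis
    proof (cases "d + j \<le> rk")
      case False
      \<comment> \<open>Since rk - j < d, the whole window lies in [0, d] and has at most d + 1 - j
        elements, and no \<open>w i\<close> satisfies \<open>w i + j \<le> rk\<close>.\<close>
      have "window E j \<subseteq> {j..rk - j}" by (auto simp: window_def)
      then have "card (window E j) \<le> Suc (rk - j) - j" by (metis card_atLeastAtMost card_mono finite_atLeastAtMost)
      moreover have "{i \<in> {1..min l r}. j \<le> t i \<and> t i + j \<le> rk \<and> j \<le> w i \<and> w i + j \<le> rk} = {}"
      proof -
        have "\<not> w i + j \<le> rk" if "i \<in> {1..min l r}" for i
          using w_gt(1)[of i] False that by (auto simp: min.bounded_iff)
        then show ?thesis by blast
      qed
      moreover have "{v \<in> E \<inter> {0..d}. j \<le> v \<and> v + j \<le> rk} = window E j"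
        using False by (auto simp: window_def)
      ultimately show ?thesis using False by simp
    next
      case True
      let ?A = "E \<inter> {j..d}"
      let ?P = "{i \<in> {1..l}. j \<le> t i}"
      let ?Q = "{i \<in> {1..r}. w i + j \<le> rk}"
      have P: "?P = {1..card ?P}"
      proof (rule initial_segment_eq[of _ l])
        fix i i' assume i: "i \<in> ?P" "1 \<le> i'" "i' \<le> i"
        then have "t i \<le> t i'"
          using monotone_onD[OF t(1), of i' i] by (cases "i' = i") auto
        then show "i' \<in> ?P" using i by auto
      qed auto
      have Q: "?Q = {1..card ?Q}"
      proof (rule initial_segment_eq[of _ r])
        fix i i' assume i: "i \<in> ?Q" "1 \<le> i'" "i' \<le> i"
        then have "w i' \<le> w i"
          using monotone_onD[OF w(1), of i' i] by (cases "i' = i") auto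
        then show "i' \<in> ?Q" using i by auto
      qed auto
      have inj_t: "inj_on t {1..l}"
        using t(1) by (simp add: strict_antimono_iff_antimono)
      have inj_w: "inj_on w {1..r}"
        using w(1) by (rule strict_mono_on_imp_inj_on)
      have "t ` ?P = (t ` {1..l}) \<inter> {j..}" by auto
      also have "\<dots> = {j..d} - ?A" unfolding t(2) by auto
      finally have "card ?P = card ({j..d} - ?A)"
        using card_image[OF inj_on_subset[OF inj_t, of ?P]] by fastforce
      then have p: "card ?P + card ?A = Suc d - j"
        using card_mono[of "{j..d}" ?A] by (simp add: card_Diff_subset)
      have "w ` ?Q = (w ` {1..r}) \<inter> {v. v + j \<le> rk}" by auto
      also have "\<dots> = window E j - ?A" unfolding w(2) using jd True by (auto simp: window_def)
      finally have "card ?Q = card (window E j - ?A)"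
        using card_image[OF inj_on_subset[OF inj_w, of ?Q]] by fastforce
      moreover have sub: "?A \<subseteq> window E j" using True by (auto simp: window_def)
      ultimately have q: "card ?Q + card ?A = card (window E j)"
        using card_mono[OF finite_window sub] finite_subset[OF sub finite_window]
        by (simp add: card_Diff_subset)
      \<comment> \<open>Two of the four conditions are automatic: t_i \<le> d \<le> rk - j and w_i >
        d \<ge> j.\<close>
      have "{i \<in> {1..min l r}. j \<le> t i \<and> t i + j \<le> rk \<and> j \<le> w i \<and> w i + j \<le> rk} = ?P \<inter> ?Q"
        using True jd t_le(1) w_gt(1) by fastforce
      also have "\<dots> = {1..card ?P} \<inter> {1..card ?Q}" using P Q by (metis (no_types, lifting))
      also have "\<dots> = {1..min (card ?P) (card ?Q)}" by auto
      finally have 1: "card {i \<in> {1..min l r}. j \<le> t i \<and> t i + j \<le> rk \<and> j \<le> w i \<and> w i + j \<le> rk}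
        = min (card ?P) (card ?Q)" by simp
      have 2: "{v \<in> E \<inter> {0..d}. j \<le> v \<and> v + j \<le> rk} = ?A" using True by auto
      show ?thesis unfolding 1 2 p[symmetric] q[symmetric] by simp
    qed
  qed
qed

lemma hilbert_fn_shell_eq:
  fixes l r :: nat
  assumes d: "d \<le> rk" and E: "E \<subseteq> {0..rk}"
    and t: "strict_antimono_on {1..l} t" "t ` {1..l} = {0..d} - E"
    and w: "strict_mono_on {1..r} w" "w ` {1..r} = E - {0..d}"
  shows "hilbert_fn d (shell E) = (\<Sum>v\<in>E \<inter> {0..d}. card (level v))
    + (\<Sum>j=1..min l r. min (card (level (t j))) (card (level (w j))))"
proof -
  let ?b = "\<lambda>j. card (prim_basis j)"
  let ?in = "\<lambda>j v. j \<le> v \<and> v + j \<le> rk"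
  have t_le: "t i \<le> rk" if "i \<in> {1..min l r}" for i
    using imageI[of i "{1..l}" t] that d unfolding t(2) by (auto simp: min.bounded_iff)
  have w_le: "w i \<le> rk" if "i \<in> {1..min l r}" for i
    using imageI[of i "{1..r}" w] that E unfolding w(2) by (auto simp: min.bounded_iff)
  have "(\<Sum>v\<in>E \<inter> {0..d}. card (level v)) = (\<Sum>v\<in>E \<inter> {0..d}. \<Sum>j\<le>rk. ?b j * (if ?in j v then 1 else 0))"
  proof (rule sum.cong[OF refl])
    fix v assume "v \<in> E \<inter> {0..d}"
    then have "v \<le> rk" using d by auto
    \<comment> \<open>The size of a single level is the minimum of that size with itself.\<close>
    from min_card_level[OF this this] show "card (level v) = (\<Sum>j\<le>rk. ?b j * (if ?in j v then 1 else 0))"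
      by (simp cong: conj_cong)
  qed
  also have "\<dots> = (\<Sum>j\<le>rk. ?b j * card {v \<in> E \<inter> {0..d}. ?in j v})"
    by (subst sum.swap) (simp add: sum_distrib_left[symmetric] sum.inter_filter[symmetric])
  finally have 1: "(\<Sum>v\<in>E \<inter> {0..d}. card (level v)) = (\<Sum>j\<le>rk. ?b j * card {v \<in> E \<inter> {0..d}. ?in j v})" .
  have "(\<Sum>i=1..min l r. min (card (level (t i))) (card (level (w i))))
    = (\<Sum>i=1..min l r. \<Sum>j\<le>rk. ?b j * (if j \<le> t i \<and> t i + j \<le> rk \<and> j \<le> w i \<and> w i + j \<le> rk then 1 else 0))"
    using t_le w_le by (intro sum.cong refl min_card_level) auto
  also have "\<dots> = (\<Sum>j\<le>rk. ?b j * card {i \<in> {1..min l r}. j \<le> t i \<and> t i + j \<le> rk \<and> j \<le> w i \<and> w i + j \<le> rk})"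
    by (subst sum.swap) (simp only: sum_distrib_left[symmetric] sum.inter_filter[symmetric] finite_atLeastAtMost card_eq_sum)
  finally have 2: "(\<Sum>i=1..min l r. min (card (level (t i))) (card (level (w i))))
    = (\<Sum>j\<le>rk. ?b j * card {i \<in> {1..min l r}. j \<le> t i \<and> t i + j \<le> rk \<and> j \<le> w i \<and> w i + j \<le> rk})" .
  \<comment> \<open>The sum can run up to rk, as \<open>Suc d - j\<close> is truncated to 0 for j >
    d.\<close>
  have "hilbert_fn d (shell E) = (\<Sum>j\<le>rk. ?b j * min (Suc d - j) (card (window E j)))"
    unfolding hilbert_fn_shell using d by (intro sum.mono_neutral_left) auto
  also have "\<dots> = (\<Sum>j\<le>rk. ?b j * card {v \<in> E \<inter> {0..d}. ?in j v})
    + (\<Sum>j\<le>rk. ?b j * card {i \<in> {1..min l r}. j \<le> t i \<and> t i + j \<le> rk \<and> j \<le> w i \<and> w i + j \<le> rk})"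
    unfolding card_window_split[OF assms] by (simp only: distrib_left sum.distrib)
  finally show ?thesis unfolding 1 2 .
qed

lemma point_pts: "point ` pts = {x. \<forall>i. x $ i \<in> real ` {0..K i}}"
proof
  show "{x. \<forall>i. x $ i \<in> real ` {0..K i}} \<subseteq> point ` pts"
  proof
    fix x :: "real ^ 'n" assume "x \<in> {x. \<forall>i. x $ i \<in> real ` {0..K i}}"
    then have "\<forall>i. \<exists>n\<le>K i. x $ i = real n" by (fastforce simp: image_iff)
    then obtain a where "\<And>i. a i \<le> K i" "\<And>i. x $ i = real (a i)" by metis
    then have "x = point a" "a \<in> pts" by (auto simp: point_def pts_def vec_eq_iff)
    then show "x \<in> point ` pts" by blast
  qed
qed (auto simp: point_def pts_def)

lemma layer_eq_shell:
  assumes "K = (\<lambda>i. k i - 1)"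
  shows "layer k E = shell E"
proof -
  have "grid k = point ` pts" unfolding point_pts by (simp add: grid_def assms)
  then show ?thesis
    unfolding layer_def shell_def by (auto simp: wt_point simp del: of_nat_sum)
qed

lemma card_shell_level: "card (shell {v}) = card (level v)"
proof -
  have "inj point" by (auto simp: inj_def point_def vec_eq_iff)
  then show ?thesis
    unfolding shell_def by (subst card_image) (auto simp: level_def inj_on_def)
qed

end

theorem theorem1p5:
  fixes k :: "'n::finite \<Rightarrow> nat" and N d l r :: nat and E :: "nat set"
    and t w :: "nat \<Rightarrow> nat"
  assumes k: "\<And>i. k i \<ge> 2"
    and N: "N = (\<Sum>i\<in>UNIV. k i - 1)"
    and d: "d \<in> {0..N}"
    and E: "E \<subseteq> {0..N}"
    and t: "strict_antimono_on {1..l} t" "t ` {1..l} = {0..d} - E"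
    and w: "strict_mono_on {1..r} w" "w ` {1..r} = E - {0..d}"
  shows "hilbert_fn d (layer k E) =
           (\<Sum>v\<in>E \<inter> {0..d}. layer_card k {v})
           + (\<Sum>j=1..min l r. min (layer_card k {t j}) (layer_card k {w j}))"
proof -
  interpret chain_product "\<lambda>i. k i - 1" .
  have "rk = N" unfolding rk_def N ..
  then have "hilbert_fn d (shell E) = (\<Sum>v\<in>E \<inter> {0..d}. card (level v))
    + (\<Sum>j=1..min l r. min (card (level (t j))) (card (level (w j))))"
    using d E by (intro hilbert_fn_shell_eq[OF _ _ t w]) auto
  then show ?thesis by (simp only: layer_card_def layer_eq_shell[OF refl] card_shell_level)
qed

end
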